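(* Let $0<q<1$ and let $\xi,\eta$ be non-negative real numbers that are sufficiently small depending only on $q$. For every $w\in A$, the series $O(ywx)$ is absolutely convergent and \[ O(ywx)=O(y\tau_{\lambda}(w)x). \]
   Context: For a positive integer $m$, $[m]=\frac{1-q^m}{1-q}$. An admissible index is a non-empty tuple of positive integers $\boldsymbol{k}=(k_1,\dots,k_r)$ with $k_r\ge 2$. For such $\boldsymbol{k}$, \[ O(\boldsymbol{k})=\sum_{0<m_1<\cdots<m_r}\prod_{i=1}^r\frac{q^{(k_i-1)m_i}}{([m_i]-q^{m_i}\xi)([m_i]-q^{m_i}\eta)[m_i]^{k_i-2}}. \] An admissible index $(k_1,\dots,k_r)$ is identified with the word $yx^{k_1-1}\cdots yx^{k_r-1}\in y\mathbb{Q}\langle x,y\rangle x$ (non-commutative polynomials in $x,y$), and $O$ is extended $\mathbb{Q}$-linearly to a map $y\mathbb{Q}\langle x,y\rangle x\to\mathbb{R}$. Let $\lambda$ be an indeterminate; in $\mathbb{Q}\langle x,y\rangle[[\lambda]]$ set $\tau_\lambda(x)=(1+yx\lambda)^{-1}y=y(1+xy\lambda)^{-1}$ and $\tau_\lambda(y)=x(1+yx\lambda)=(1+xy\lambda)x$. Let $A$ be the subring of $\mathbb{Q}\langle x,y\rangle[[\lambda]]$ generated by $x,y,\lambda$ and $(1+yx\lambda)^{-1}$, and extend $\tau_\lambda$ to the $\mathbb{Q}$-anti-automorphism of $A$ with $\tau_\lambda(\lambda)=\lambda$ (so $\tau_\lambda((1+yx\lambda)^{-1})=(1+yx\lambda)^{-1}$).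 For $w=\sum_{i\ge0}w_i\lambda^i\in A$ (with $w_i\in\mathbb{Q}\langle x,y\rangle$), define $O(ywx)=\sum_{i\ge 0}O(yw_ix)\xi^i\eta^i$. *)

theory Defs
  imports
    "HOL-Library.Poly_Mapping"
    "HOL-Computational_Algebra.Formal_Power_Series"
    "HOL-Analysis.Infinite_Sum"
begin

text \<open>
  The free algebra over the rationals on \<open>x\<close>, \<open>y\<close> is the monoid algebra of the free monoid on
  two letters, i.e. finitely supported functions from words to the rationals with convolution.
  \<^theory>\<open>HOL-Library.Poly_Mapping\<close> writes the monoid additively, so addition of words below is
  (non-commutative) concatenation.
\<close>

datatype letter = X | Y

datatype word = Word (letters: "letter list")

instantiation word :: monoid_add
begin

definition zero_word :: word where "0 = Word []"

definition plus_word :: "word \<Rightarrow> word \<Rightarrow> word" where "v + w = Word (letters v @ letters w)"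

instance
  by standard (simp_all add: zero_word_def plus_word_def)

end

type_synonym nc_poly = "word \<Rightarrow>\<^sub>0 rat"

abbreviation monomial :: "letter list \<Rightarrow> nc_poly" where
  "monomial v \<equiv> Poly_Mapping.single (Word v) 1"

text \<open>
  In \<^typ>\<open>nc_poly fps\<close> the central indeterminate \<open>\<lambda>\<close> is \<^const>\<open>fps_X\<close>.
\<close>

definition gen_x :: "nc_poly fps" where "gen_x = fps_const (monomial [X])"

definition gen_y :: "nc_poly fps" where "gen_y = fps_const (monomial [Y])"

definition scalar :: "rat \<Rightarrow> nc_poly fps" where
  "scalar c = fps_const (Poly_Mapping.single 0 c)"

definition one_yx :: "nc_poly fps" where "one_yx = 1 + gen_y * gen_x * fps_X"

definition inv_yx :: "nc_poly fps" where "inv_yx = fps_left_inverse one_yx 1"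

lemma fps_X_central: "fps_X * (f :: nc_poly fps) = f * fps_X"
  by (simp add: fps_mult_fps_X_commute)

lemma inv_yx_left: "inv_yx * one_yx = 1"
  unfolding inv_yx_def by (rule fps_left_inverse) (simp add: one_yx_def)

lemma inv_yx_right: "one_yx * inv_yx = 1"
proof -
  have r: "one_yx * fps_right_inverse one_yx 1 = 1"
    by (rule fps_right_inverse) (simp add: one_yx_def)
  have "inv_yx = inv_yx * (one_yx * fps_right_inverse one_yx 1)"
    by (simp only: r mult_1_right)
  also have "\<dots> = fps_right_inverse one_yx 1"
    by (simp only: mult.assoc [symmetric] inv_yx_left mult_1_left)
  finally show ?thesis using r by simp
qed

text \<open>
  The rational scalars are among the generators (``subring'' is read as \<open>\<rat>\<close>-subalgebra, as needed for
  a \<open>\<rat>\<close>-anti-automorphism); closure under negation comes from multiplication by \<open>scalar (- 1)\<close>.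
\<close>

inductive_set alg_A :: "nc_poly fps set" where
  scalar: "scalar c \<in> alg_A"
| x: "gen_x \<in> alg_A"
| y: "gen_y \<in> alg_A"
| lam: "fps_X \<in> alg_A"
| inv: "inv_yx \<in> alg_A"
| add: "\<lbrakk>f \<in> alg_A; g \<in> alg_A\<rbrakk> \<Longrightarrow> f + g \<in> alg_A"
| mult: "\<lbrakk>f \<in> alg_A; g \<in> alg_A\<rbrakk> \<Longrightarrow> f * g \<in> alg_A"

text \<open>
  \<open>tau\<close> is given on all of \<^typ>\<open>nc_poly fps\<close> as the \<open>\<lambda>\<close>-linear, \<open>\<lambda>\<close>-adically continuous
  anti-endomorphism with the prescribed values on \<open>x\<close> and \<open>y\<close>: the coefficient of \<open>\<lambda>\<^sup>n\<close>
  in \<open>\<Sum>\<^sub>i tau (f\<^sub>i) \<lambda>\<^sup>i\<close> is a finite sum. That it restricts to the unique anti-automorphism of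
  \<^const>\<open>alg_A\<close> with these values is proved below.
\<close>

fun tau_letter :: "letter \<Rightarrow> nc_poly fps" where
  "tau_letter X = inv_yx * gen_y"
| "tau_letter Y = gen_x * one_yx"

definition tau_word :: "word \<Rightarrow> nc_poly fps" where
  "tau_word v = prod_list (rev (map tau_letter (letters v)))"

definition tau_poly :: "nc_poly \<Rightarrow> nc_poly fps" where
  "tau_poly p = (\<Sum>v\<in>Poly_Mapping.keys p. scalar (Poly_Mapping.lookup p v) * tau_word v)"

definition tau :: "nc_poly fps \<Rightarrow> nc_poly fps" where
  "tau f = Abs_fps (\<lambda>n. \<Sum>i\<le>n. fps_nth (tau_poly (fps_nth f i)) (n - i))"

lemma scalar_0 [simp]: "scalar 0 = 0"
  by (simp add: scalar_def)

lemma scalar_1 [simp]: "scalar 1 = 1"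
  by (simp add: scalar_def)

lemma scalar_add: "scalar (a + b) = scalar a + scalar b"
  by (simp add: scalar_def single_add)

lemma scalar_mult: "scalar (a * b) = scalar a * scalar b"
  by (simp add: scalar_def mult_single)

lemma nc_poly_induct [case_names zero single add]:
  fixes p :: nc_poly
  assumes zero: "P 0" and single: "\<And>v c. P (Poly_Mapping.single v c)"
    and add: "\<And>p r. \<lbrakk>P p; P r\<rbrakk> \<Longrightarrow> P (p + r)"
  shows "P p"
proof -
  have "P (\<Sum>v\<in>S. Poly_Mapping.single v (Poly_Mapping.lookup p v))" for S
    by (induction S rule: infinite_finite_induct) (simp_all add: zero single add)
  moreover have "(\<Sum>v\<in>Poly_Mapping.keys p. Poly_Mapping.single v (Poly_Mapping.lookup p v)) = p"
    by (rule poly_mapping_eqI)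
      (simp add: lookup_sum lookup_single when_def in_keys_iff)
  ultimately show ?thesis by metis
qed

lemma single_0_central: "Poly_Mapping.single 0 c * p = p * Poly_Mapping.single 0 c"
  for p :: nc_poly
proof (induction p rule: nc_poly_induct)
  case (single v c)
  then show ?case by (simp add: mult_single mult.commute)
next
  case (add p r)
  then show ?case by (simp add: distrib_left distrib_right)
qed simp

lemma scalar_central: "scalar c * f = f * scalar c"
  by (rule fps_ext) (simp add: scalar_def single_0_central)

lemma tau_word_0 [simp]: "tau_word 0 = 1"
  by (simp add: tau_word_def zero_word_def)

lemma tau_word_add: "tau_word (v + w) = tau_word w * tau_word v"
  by (simp add: tau_word_def plus_word_def)

lemma tau_poly_0 [simp]: "tau_poly 0 = 0"
  by (simp add: tau_poly_def)

lemma tau_poly_single: "tau_poly (Poly_Mapping.single v c) = scalar c * tau_word v"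
  by (simp add: tau_poly_def)

lemma tau_poly_add: "tau_poly (p + r) = tau_poly p + tau_poly r"
  unfolding tau_poly_def
  by (rule setsum_keys_plus_distrib) (simp_all add: scalar_add distrib_right)

lemma tau_poly_sum: "tau_poly (sum p I) = (\<Sum>i\<in>I. tau_poly (p i))"
  by (induction I rule: infinite_finite_induct) (simp_all add: tau_poly_add)

lemma tau_poly_mult: "tau_poly (p * r) = tau_poly r * tau_poly p"
proof (induction p rule: nc_poly_induct)
  case (single v c)
  show ?case
  proof (induction r rule: nc_poly_induct)
    case (single w d)
    have "scalar c * scalar d * (tau_word w * tau_word v) =
        scalar d * tau_word w * (scalar c * tau_word v)"
      by (simp add: mult.assoc scalar_central [of c])
    then show ?case
      by (simp add: mult_single tau_poly_single tau_word_add scalar_mult)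
  next
    case (add p r)
    then show ?case by (simp add: distrib_left distrib_right tau_poly_add)
  qed simp
next
  case (add p r)
  then show ?case by (simp add: distrib_left distrib_right tau_poly_add)
qed simp

lemma tau_nth: "fps_nth (tau f) n = (\<Sum>i\<le>n. fps_nth (tau_poly (fps_nth f i)) (n - i))"
  by (simp add: tau_def)

theorem tau_add: "tau (f + g) = tau f + tau g"
  by (rule fps_ext) (simp add: tau_nth tau_poly_add sum.distrib)

lemma tau_fps_const: "tau (fps_const p) = tau_poly p"
proof (rule fps_ext)
  fix n
  have "(\<Sum>i\<le>n. fps_nth (tau_poly (fps_nth (fps_const p) i)) (n - i)) =
      (\<Sum>i\<in>{0}. fps_nth (tau_poly (fps_nth (fps_const p) i)) (n - i))"
    by (rule sum.mono_neutral_right) auto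
  then show "fps_nth (tau (fps_const p)) n = fps_nth (tau_poly p) n"
    by (simp add: tau_nth)
qed

theorem tau_mult: "tau (f * g) = tau g * tau f"
proof (rule fps_ext)
  fix n
  define F where "F = (\<lambda>i k. fps_nth (tau_poly (fps_nth f i)) k)"
  define G where "G = (\<lambda>i k. fps_nth (tau_poly (fps_nth g i)) k)"
  have "fps_nth (tau (f * g)) n =
      (\<Sum>i\<le>n. \<Sum>j=0..i. \<Sum>k=0..n - i. G (i - j) k * F j (n - i - k))"
    by (simp add: tau_nth fps_mult_nth tau_poly_sum tau_poly_mult fps_sum_nth F_def G_def)
  also have "\<dots> = (\<Sum>(i, j, k)\<in>(SIGMA i:{..n}. SIGMA j:{0..i}. {0..n - i}).
      G (i - j) k * F j (n - i - k))"
    by (simp add: sum.Sigma)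
  also have "\<dots> = (\<Sum>(a, b, c)\<in>(SIGMA a:{0..n}. SIGMA b:{..a}. {..n - a}).
      G b (a - b) * F c (n - a - c))"
    by (rule sum.reindex_bij_witness
        [where i = "\<lambda>(a, b, c). (b + c, c, a - b)" and j = "\<lambda>(i, j, k). (i - j + k, i - j, j)"])
      auto
  also have "\<dots> = (\<Sum>a=0..n. \<Sum>b\<le>a. \<Sum>c\<le>n - a. G b (a - b) * F c (n - a - c))"
    by (simp add: sum.Sigma)
  also have "\<dots> = fps_nth (tau g * tau f) n"
    by (simp add: tau_nth fps_mult_nth F_def G_def sum_product)
  finally show "fps_nth (tau (f * g)) n = fps_nth (tau g * tau f) n" .
qed

theorem tau_scalar: "tau (scalar c) = scalar c"
  by (simp add: scalar_def tau_fps_const tau_poly_single)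

lemma tau_1: "tau 1 = 1"
  using tau_scalar [of 1] by simp

theorem tau_x: "tau gen_x = inv_yx * gen_y"
  by (simp add: gen_x_def tau_fps_const tau_poly_single tau_word_def)

theorem tau_y: "tau gen_y = gen_x * one_yx"
  by (simp add: gen_y_def tau_fps_const tau_poly_single tau_word_def)

theorem tau_lambda: "tau fps_X = fps_X"
proof (rule fps_ext)
  fix n
  have "(\<Sum>i\<le>n. fps_nth (tau_poly (fps_nth fps_X i)) (n - i)) =
      (\<Sum>i\<in>{1} \<inter> {..n}. fps_nth (tau_poly (fps_nth fps_X i)) (n - i))"
    by (rule sum.mono_neutral_right) auto
  also have "\<dots> = fps_nth fps_X n"
  proof -
    have "tau_poly 1 = 1"
      using tau_poly_single [of 0 1] by simp
    then show ?thesis by (cases "n = 0") auto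
  qed
  finally show "fps_nth (tau fps_X) n = fps_nth fps_X n"
    by (simp add: tau_nth)
qed

lemma tau_one_yx: "tau one_yx = one_yx"
proof -
  define z where "z = gen_y * gen_x"
  have z: "one_yx = 1 + z * fps_X" by (simp add: one_yx_def z_def)
  have "z * one_yx = one_yx * z"
    by (simp add: z distrib_left distrib_right mult.assoc fps_X_central)
  then have "inv_yx * (z * one_yx) = z"
    by (simp add: mult.assoc [symmetric] inv_yx_left)
  then have "tau z = z"
    by (simp add: z_def tau_mult tau_x tau_y mult.assoc)
  then show ?thesis
    by (simp add: z tau_add tau_1 tau_mult tau_lambda fps_X_central)
qed

theorem tau_inv_yx: "tau inv_yx = inv_yx"
proof -
  have "one_yx * tau inv_yx = tau (inv_yx * one_yx)"
    by (simp add: tau_mult tau_one_yx)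
  also have "\<dots> = 1" by (simp add: inv_yx_left tau_1)
  finally have "inv_yx * (one_yx * tau inv_yx) = inv_yx" by simp
  then show ?thesis by (simp add: mult.assoc [symmetric] inv_yx_left)
qed

lemma one_yx_in_A: "one_yx \<in> alg_A"
  using alg_A.scalar [of 1] by (auto simp: one_yx_def intro!: alg_A.intros)

lemma tau_in_A: "f \<in> alg_A \<Longrightarrow> tau f \<in> alg_A"
  by (induction rule: alg_A.induct)
    (simp_all add: tau_scalar tau_x tau_y tau_lambda tau_inv_yx tau_add tau_mult
      alg_A.intros one_yx_in_A)

lemma tau_tau: "f \<in> alg_A \<Longrightarrow> tau (tau f) = f"
proof (induction rule: alg_A.induct)
  case x
  show ?case
    by (simp add: tau_x tau_y tau_mult tau_inv_yx mult.assoc inv_yx_right)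
next
  case y
  show ?case
    by (simp add: tau_x tau_y tau_mult tau_one_yx mult.assoc [symmetric] inv_yx_right)
qed (simp_all add: tau_scalar tau_lambda tau_inv_yx tau_add tau_mult)

theorem tau_bij: "bij_betw tau alg_A alg_A"
  by (rule bij_betw_byWitness [where f' = tau]) (auto simp: tau_tau tau_in_A)

theorem tau_unique:
  assumes "\<And>f g. \<lbrakk>f \<in> alg_A; g \<in> alg_A\<rbrakk> \<Longrightarrow> t (f + g) = t f + t g"
    and "\<And>f g. \<lbrakk>f \<in> alg_A; g \<in> alg_A\<rbrakk> \<Longrightarrow> t (f * g) = t g * t f"
    and "\<And>c. t (scalar c) = scalar c"
    and "t gen_x = inv_yx * gen_y" and "t gen_y = gen_x * one_yx" and "t fps_X = fps_X"
    and "f \<in> alg_A"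
  shows "t f = tau f"
  using assms(7)
proof (induction rule: alg_A.induct)
  case inv
  have 1: "1 \<in> alg_A" using alg_A.scalar [of 1] by simp
  have "t one_yx = 1 + fps_X * (t gen_x * t gen_y)"
    unfolding one_yx_def using assms(3) [of 1]
    by (simp add: assms(1,2,6) alg_A.intros 1)
  also have "\<dots> = tau one_yx"
    by (simp add: assms(4,5) tau_x tau_y tau_mult tau_add tau_1 tau_lambda
        one_yx_def [THEN arg_cong [where f = tau]])
  finally have "t one_yx = one_yx" by (simp add: tau_one_yx)
  then have "one_yx * t inv_yx = t (inv_yx * one_yx)"
    by (simp add: assms(2) alg_A.intros one_yx_in_A)
  also have "\<dots> = 1" using assms(3) [of 1] by (simp add: inv_yx_left)
  finally have "inv_yx * (one_yx * t inv_yx) = inv_yx" by simp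
  then show ?case by (simp add: mult.assoc [symmetric] inv_yx_left tau_inv_yx)
qed (simp_all add: assms tau_scalar tau_x tau_y tau_lambda tau_add tau_mult)

definition admissible :: "nat list \<Rightarrow> bool" where
  "admissible ks \<longleftrightarrow> ks \<noteq> [] \<and> (\<forall>k\<in>set ks. 1 \<le> k) \<and> 2 \<le> last ks"

definition index_word :: "nat list \<Rightarrow> word" where
  "index_word ks = Word (concat (map (\<lambda>k. Y # replicate (k - 1) X) ks))"

definition qbracket :: "real \<Rightarrow> nat \<Rightarrow> real" where
  "qbracket q m = (1 - q ^ m) / (1 - q)"

definition increasing_tuples :: "nat \<Rightarrow> nat list set" where
  "increasing_tuples r = {ms. length ms = r \<and> sorted_wrt (<) ms \<and> (\<forall>m\<in>set ms. 0 < m)}"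

definition O_term :: "real \<Rightarrow> real \<Rightarrow> real \<Rightarrow> nat list \<Rightarrow> nat list \<Rightarrow> real" where
  "O_term q \<xi> \<eta> ks ms = (\<Prod>i<length ks.
     q ^ ((ks ! i - 1) * ms ! i) /
     ((qbracket q (ms ! i) - q ^ (ms ! i) * \<xi>) * (qbracket q (ms ! i) - q ^ (ms ! i) * \<eta>) *
      qbracket q (ms ! i) powi (int (ks ! i) - 2)))"

definition O_index :: "real \<Rightarrow> real \<Rightarrow> real \<Rightarrow> nat list \<Rightarrow> real" where
  "O_index q \<xi> \<eta> ks = (\<Sum>\<^sub>\<infinity>ms\<in>increasing_tuples (length ks). O_term q \<xi> \<eta> ks ms)"

text \<open>
  The linear extension of \<^const>\<open>O_index\<close> to the span of the words that start with \<open>y\<close> and end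
  with \<open>x\<close>. By \<open>bij_betw_index_word\<close> below, these are exactly the words of admissible indices.
\<close>

definition O_poly :: "real \<Rightarrow> real \<Rightarrow> real \<Rightarrow> nc_poly \<Rightarrow> real" where
  "O_poly q \<xi> \<eta> p = (\<Sum>ks | admissible ks \<and> index_word ks \<in> Poly_Mapping.keys p.
     of_rat (Poly_Mapping.lookup p (index_word ks)) * O_index q \<xi> \<eta> ks)"

lemma letters_index_word_Nil [simp]: "letters (index_word []) = []"
  by (simp add: index_word_def)

lemma letters_index_word_Cons [simp]:
  "letters (index_word (k # ks)) = Y # replicate (k - 1) X @ letters (index_word ks)"
  by (simp add: index_word_def)

lemma index_word_inj:
  assumes "index_word ks = index_word ls" and "\<forall>k\<in>set ks. 1 \<le> k" and "\<forall>l\<in>set ls. 1 \<le> l"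
  shows "ks = ls"
  using assms
proof (induction ks arbitrary: ls)
  case Nil
  then show ?case
    by (cases ls) (auto simp: index_word_def)
next
  case (Cons k ks)
  then obtain l ls' where ls: "ls = l # ls'"
    by (cases ls) (auto simp: index_word_def)
  have *: "takeWhile (\<lambda>a. a = X) (replicate n X @ letters (index_word js)) = replicate n X" for n js
    by (cases js) (simp_all add: takeWhile_append)
  have eq: "replicate (k - 1) X @ letters (index_word ks) =
      replicate (l - 1) X @ letters (index_word ls')"
    using arg_cong [OF Cons.prems(1), of letters] by (simp add: ls)
  then have "replicate (k - 1) X = replicate (l - 1) X"
    using * [of "k - 1" ks] * [of "l - 1" ls'] by simp
  from arg_cong [OF this, of length] have kl: "k - 1 = l - 1"
    by simp
  with eq have "index_word ks = index_word ls'"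
    by (simp add: word.expand)
  then have "ks = ls'" using Cons ls by auto
  with kl Cons.prems ls show ?case by force
qed

lemma index_word_surj:
  "\<exists>ks. index_word ks = Word (Y # v) \<and> ks \<noteq> [] \<and> (\<forall>k\<in>set ks. 1 \<le> k)"
proof (induction v)
  case Nil
  show ?case by (rule exI [of _ "[1]"]) (simp add: index_word_def)
next
  case (Cons a v)
  then obtain k ks where ks: "index_word (k # ks) = Word (Y # v)" "\<forall>k\<in>set (k # ks). 1 \<le> k"
    by (metis list.exhaust)
  show ?case
  proof (cases a)
    case Y
    with ks show ?thesis
      by (intro exI [of _ "1 # k # ks"]) (auto simp: index_word_def)
  next
    case X
    from ks have "k \<noteq> 0" by auto
    then obtain n where "k = Suc n" by (cases k) auto
    with X ks show ?thesis
      by (intro exI [of _ "Suc k # ks"]) (auto simp: index_word_def)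
  qed
qed

theorem bij_betw_index_word:
  "bij_betw index_word {ks. admissible ks} {Word (Y # v @ [X]) | v. True}"
proof (rule bij_betwI')
  fix ks ls assume "ks \<in> {ks. admissible ks}" "ls \<in> {ks. admissible ks}"
  then show "(index_word ks = index_word ls) = (ks = ls)"
    using index_word_inj by (auto simp: admissible_def)
next
  fix ks assume "ks \<in> {ks. admissible ks}"
  then have ks: "ks \<noteq> []" "2 \<le> last ks" by (auto simp: admissible_def)
  define js where "js = butlast ks"
  define n where "n = last ks - 2"
  have "ks = js @ [Suc (Suc n)]"
  proof -
    have "Suc (Suc n) = last ks" using ks by (simp add: n_def)
    then show ?thesis using ks by (simp add: js_def)
  qed
  then have "index_word ks = Word (letters (index_word js) @ Y # replicate n X @ [X])"
    by (simp add: index_word_def replicate_append_same)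
  moreover have "\<exists>v. letters (index_word js) @ Y # replicate n X @ [X] = Y # v @ [X]"
    by (cases js) auto
  ultimately show "index_word ks \<in> {Word (Y # v @ [X]) | v. True}" by auto
next
  fix w assume "w \<in> {Word (Y # v @ [X]) | v. True}"
  then obtain v where w: "w = Word (Y # v @ [X])" by auto
  obtain ks where ks: "index_word ks = w" "ks \<noteq> []" "\<forall>k\<in>set ks. 1 \<le> k"
    using index_word_surj [of "v @ [X]"] w by auto
  define js where "js = butlast ks"
  have ks': "ks = js @ [last ks]"
    using ks by (simp add: js_def)
  have "last ks \<noteq> 1"
  proof
    assume "last ks = 1"
    then have "letters (index_word ks) = letters (index_word js) @ [Y]"
      by (subst ks') (simp add: index_word_def)
    then have "last (letters (index_word ks)) = Y" by simp
    moreover have "last (letters (index_word ks)) = X" by (simp add: ks(1) w)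
    ultimately show False by simp
  qed
  moreover have "1 \<le> last ks" using ks by simp
  ultimately have "2 \<le> last ks" by linarith
  then have "admissible ks" using ks by (simp add: admissible_def)
  with ks show "\<exists>ks\<in>{ks. admissible ks}. w = index_word ks" by auto
qed

lemma inj_on_index_word: "inj_on index_word {ks. admissible ks}"
  using bij_betw_index_word by (rule bij_betw_imp_inj_on)

lemma finite_index_keys:
  "finite {ks. admissible ks \<and> index_word ks \<in> Poly_Mapping.keys p}"
  by (rule finite_imageD [OF finite_subset [OF _ finite_keys [of p]]])
    (auto intro: inj_on_subset [OF inj_on_index_word])

lemma O_poly_index:
  assumes "admissible ks"
  shows "O_poly q \<xi> \<eta> (Poly_Mapping.single (index_word ks) c) = of_rat c * O_index q \<xi> \<eta> ks"
proof -
  have "{ls. admissible ls \<and> index_word ls = index_word ks} = {ks}"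
    using assms inj_on_index_word by (auto dest: inj_onD)
  then show ?thesis
    by (cases "c = 0") (simp_all add: O_poly_def)
qed

lemma O_poly_add: "O_poly q \<xi> \<eta> (p + r) = O_poly q \<xi> \<eta> p + O_poly q \<xi> \<eta> r"
proof -
  define S where "S = {ks. admissible ks \<and> index_word ks \<in> Poly_Mapping.keys p \<union> Poly_Mapping.keys r}"
  have "finite S"
    using finite_index_keys [of p] finite_index_keys [of r]
    by (auto simp: S_def conj_disj_distribL Collect_disj_eq)
  have *: "O_poly q \<xi> \<eta> s =
      (\<Sum>ks\<in>S. of_rat (Poly_Mapping.lookup s (index_word ks)) * O_index q \<xi> \<eta> ks)"
    if "Poly_Mapping.keys s \<subseteq> Poly_Mapping.keys p \<union> Poly_Mapping.keys r" for s
    unfolding O_poly_def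
    by (rule sum.mono_neutral_left) (use that \<open>finite S\<close> in \<open>auto simp: S_def in_keys_iff\<close>)
  show ?thesis
    using keys_add [of p r]
    by (simp add: * lookup_add of_rat_add distrib_right sum.distrib)
qed

definition O_series :: "real \<Rightarrow> real \<Rightarrow> real \<Rightarrow> nc_poly fps \<Rightarrow> real" where
  "O_series q \<xi> \<eta> W = suminf (\<lambda>i. O_poly q \<xi> \<eta> (fps_nth W i) * \<xi> ^ i * \<eta> ^ i)"

end

theory Submission
  imports
    Defs
    "HOL-Analysis.Bounded_Linear_Function"
    "HOL-Analysis.Bounded_Continuous_Function"
    "HOL-Analysis.Infinite_Products"
begin

text \<open>
  Let \<open>X\<close> multiply a function of \<open>m\<close> by \<open>q\<^sup>m / [m]\<close> and let \<open>(Y f) m\<close> be the sum over \<open>a > m\<close> of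
  \<open>[a] / (([a] - q\<^sup>a \<xi>) ([a] - q\<^sup>a \<eta>)) \<cdot> f a\<close>. Then \<open>O\<close> of a word is the word, acting on the constant
  function 1, evaluated at 0. With \<open>\<alpha> = 1 + (1 - q) \<xi>\<close> and \<open>\<beta> = 1 + (1 - q) \<eta>\<close> put
  \<open>C m n = K q\<^sup>m\<^sup>n F(m) F(n) / G(m + n)\<close>, where \<open>F(m)\<close> is the product of
  \<open>(1 - \<alpha> q\<^sup>a) (1 - \<beta> q\<^sup>a) / (1 - q\<^sup>a)\<close> and \<open>G(m)\<close> that of \<open>1 - \<alpha> \<beta> q\<^sup>a\<close> over \<open>1 \<le> a \<le> m\<close>, and
  \<open>K = lim G / F\<close>. This symmetric kernel intertwines the action in \<open>m\<close> with the one in \<open>n\<close>: writing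
  \<open>D = 1 + \<xi> \<eta> Y X\<close>, telescoping gives \<open>D\<^sub>m C = D\<^sub>n C\<close> and \<open>Y\<^sub>m C = X\<^sub>n D\<^sub>n C\<close>, so that
  \<open>w\<^sub>m C = (\<tau> w)\<^sub>n C\<close> for all \<open>w\<close> in \<open>A\<close>. Since moreover \<open>(Y\<^sub>n C)(m, 0) = q\<^sup>m / [m]\<close>, both
  \<open>O(y w x)\<close> and \<open>O(y \<tau>(w) x)\<close> equal \<open>Y\<^sub>m Y\<^sub>n w\<^sub>m C\<close> at \<open>(0, 0)\<close>.

  Convergence is that of a Neumann series: \<open>X\<close> and \<open>Y\<close> are bounded on functions that are
  \<open>O(q\<^sup>m)\<close>, so \<open>D\<close> is invertible for small \<open>\<xi> \<eta>\<close>.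
\<close>

text \<open>The family \<open>pr (f i) (g j)\<close> is absolutely summable over all pairs; summed
  by rows it gives the right-hand side, by antidiagonals the convolution. It is applied to
  composition of operators.\<close>

lemma Cauchy_product_bounded_bilinear:
  fixes f :: "nat \<Rightarrow> 'a::banach" and g :: "nat \<Rightarrow> 'b::banach"
    and pr :: "'a \<Rightarrow> 'b \<Rightarrow> 'c::banach"
  assumes "bounded_bilinear pr"
    and f: "summable (\<lambda>i. norm (f i))" and g: "summable (\<lambda>i. norm (g i))"
  shows "(\<lambda>n. \<Sum>i\<le>n. pr (f i) (g (n - i))) sums pr (suminf f) (suminf g)"
proof -
  interpret bounded_bilinear pr by fact
  obtain B where "0 \<le> B" and B: "\<And>a b. norm (pr a b) \<le> norm a * norm b * B"
    using nonneg_bounded by blast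
  have f': "(\<lambda>i. norm (f i)) summable_on UNIV" and g': "(\<lambda>i. norm (g i)) summable_on UNIV"
    using f g by (simp_all add: summable_nonneg_imp_summable_on)
  have hf: "(f has_sum suminf f) UNIV" and hg: "(g has_sum suminf g) UNIV"
    using f g by (auto intro!: norm_summable_imp_has_sum summable_sums summable_norm_cancel)
  have "(\<lambda>(i, j). norm (f i) * norm (g j)) abs_summable_on UNIV \<times> UNIV"
    using f' g'
    by (subst abs_summable_on_Sigma_iff)
      (simp add: infsum_cmult_right' summable_on_cmult_left summable_on_cmult_right infsum_nonneg)
  then have "(\<lambda>(i, j). norm (f i) * norm (g j) * B) abs_summable_on UNIV \<times> UNIV"
    using \<open>0 \<le> B\<close> by (auto simp: case_prod_unfold abs_mult intro: summable_on_cmult_left)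
  then have "(\<lambda>(i, j). pr (f i) (g j)) abs_summable_on UNIV \<times> UNIV"
    by (rule abs_summable_on_comparison_test) (use \<open>0 \<le> B\<close> in \<open>auto intro: order_trans [OF B]\<close>)
  then have "(\<lambda>(i, j). pr (f i) (g j)) summable_on UNIV \<times> UNIV"
    by (rule abs_summable_summable)
  then obtain S where S: "((\<lambda>(i, j). pr (f i) (g j)) has_sum S) (UNIV \<times> UNIV)"
    by (auto simp: summable_on_def)
  have "((\<lambda>i. pr (f i) (suminf g)) has_sum S) UNIV"
    by (rule has_sum_SigmaD [OF S])
      (use has_sum_bounded_linear [OF bounded_linear_right hg] in \<open>simp add: o_def\<close>)
  moreover have "((\<lambda>i. pr (f i) (suminf g)) has_sum pr (suminf f) (suminf g)) UNIV"
    using has_sum_bounded_linear [OF bounded_linear_left hf] by (simp add: o_def)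
  ultimately have "S = pr (suminf f) (suminf g)"
    by (rule has_sum_unique)
  \<comment> \<open>The pair \<open>(n, i)\<close> encodes \<open>(i, n - i)\<close>, a point of the
    \<open>n\<close>-th antidiagonal.\<close>
  have "((\<lambda>(n, i). pr (f i) (g (n - i))) has_sum S) (SIGMA n:UNIV. {..n})"
    using S
    by (rule has_sum_reindex_bij_witness
        [where i = "\<lambda>(n, i). (i, n - i)" and j = "\<lambda>(i, j). (i + j, i)", THEN iffD1, rotated -1])
      auto
  then have "((\<lambda>n. \<Sum>i\<le>n. pr (f i) (g (n - i))) has_sum S) UNIV"
    by (rule has_sum_SigmaD) (auto intro: has_sum_finiteI)
  then show ?thesis
    using \<open>S = _\<close> by (auto intro: has_sum_imp_sums)
qed

section \<open>Representations of the free algebra by bounded operators\<close>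

fun op_word :: "(letter \<Rightarrow> 'a \<Rightarrow>\<^sub>L 'a) \<Rightarrow> letter list \<Rightarrow> 'a::real_normed_vector \<Rightarrow>\<^sub>L 'a" where
  "op_word e [] = id_blinfun"
| "op_word e (l # v) = e l o\<^sub>L op_word e v"

definition op_poly :: "(letter \<Rightarrow> 'a \<Rightarrow>\<^sub>L 'a) \<Rightarrow> nc_poly \<Rightarrow> 'a::real_normed_vector \<Rightarrow>\<^sub>L 'a" where
  "op_poly e p = (\<Sum>v\<in>Poly_Mapping.keys p. of_rat (Poly_Mapping.lookup p v) *\<^sub>R op_word e (letters v))"

definition op_term :: "(letter \<Rightarrow> 'a \<Rightarrow>\<^sub>L 'a) \<Rightarrow> real \<Rightarrow> nc_poly fps \<Rightarrow> nat \<Rightarrow> 'a::real_normed_vector \<Rightarrow>\<^sub>L 'a" where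
  "op_term e t w i = t ^ i *\<^sub>R op_poly e (fps_nth w i)"

text \<open>Evaluation at x = \<open>e X\<close>, y = \<open>e Y\<close>, \<lambda> =
  \<open>t\<close>; the leftmost letter of a word is applied last.\<close>

definition op_series :: "(letter \<Rightarrow> 'a \<Rightarrow>\<^sub>L 'a) \<Rightarrow> real \<Rightarrow> nc_poly fps \<Rightarrow> 'a::banach \<Rightarrow>\<^sub>L 'a" where
  "op_series e t w = suminf (op_term e t w)"

lemma blinfun_compose_assoc: "(a o\<^sub>L b) o\<^sub>L c = a o\<^sub>L (b o\<^sub>L c)"
  by (rule blinfun_eqI) simp

lemma id_blinfun_compose [simp]: "id_blinfun o\<^sub>L a = a" "a o\<^sub>L id_blinfun = a"
  by (auto intro: blinfun_eqI)

lemmas blinfun_compose_bilinear =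
  bounded_bilinear.add_left [OF bounded_bilinear_blinfun_compose]
  bounded_bilinear.add_right [OF bounded_bilinear_blinfun_compose]
  bounded_bilinear.scaleR_left [OF bounded_bilinear_blinfun_compose]
  bounded_bilinear.scaleR_right [OF bounded_bilinear_blinfun_compose]

lemma op_word_append: "op_word e (u @ v) = op_word e u o\<^sub>L op_word e v"
  by (induction u) (simp_all add: blinfun_compose_assoc)

lemma op_poly_0 [simp]: "op_poly e 0 = 0"
  by (simp add: op_poly_def)

lemma op_poly_single: "op_poly e (Poly_Mapping.single v c) = of_rat c *\<^sub>R op_word e (letters v)"
  by (simp add: op_poly_def)

lemma op_poly_1 [simp]: "op_poly e 1 = id_blinfun"
proof -
  have "letters 0 = []" by (simp add: zero_word_def)
  then show ?thesis using op_poly_single [of e 0 1] by simp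
qed

lemma op_poly_add: "op_poly e (p + r) = op_poly e p + op_poly e r"
  unfolding op_poly_def
  by (rule setsum_keys_plus_distrib) (simp_all add: of_rat_add scaleR_add_left)

lemma op_poly_sum: "op_poly e (sum p I) = (\<Sum>i\<in>I. op_poly e (p i))"
  by (induction I rule: infinite_finite_induct) (simp_all add: op_poly_add)

lemma op_poly_mult: "op_poly e (p * r) = op_poly e p o\<^sub>L op_poly e r"
proof (induction p rule: nc_poly_induct)
  case (single v c)
  show ?case
  proof (induction r rule: nc_poly_induct)
    case (single w d)
    show ?case
      by (simp add: mult_single op_poly_single plus_word_def op_word_append of_rat_mult
          blinfun_compose_bilinear)
  next
    case (add p r)
    then show ?case by (simp add: distrib_left op_poly_add blinfun_compose_bilinear)
  qed simp
next
  case (add p r)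
  then show ?case by (simp add: distrib_right op_poly_add blinfun_compose_bilinear)
qed simp

lemma op_poly_uminus: "op_poly e (- p) = - op_poly e p"
  using op_poly_add [of e p "- p"] by (simp add: eq_neg_iff_add_eq_0 add.commute)

lemma op_poly_power_norm: "norm (op_poly e (p ^ n)) \<le> norm (op_poly e p) ^ n"
proof (induction n)
  case 0
  show ?case by (simp add: norm_blinfun_id_le)
next
  case (Suc n)
  have "norm (op_poly e (p ^ Suc n)) \<le> norm (op_poly e p) * norm (op_poly e (p ^ n))"
    by (simp add: op_poly_mult norm_blinfun_compose)
  also have "\<dots> \<le> norm (op_poly e p) * norm (op_poly e p) ^ n"
    by (rule mult_left_mono [OF Suc]) simp
  finally show ?case by simp
qed

text \<open>The geometric series of \<open>- yx\<close>; its recursion comes from comparing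
  coefficients in \<open>one_yx * inv_yx = 1\<close>.\<close>

lemma inv_yx_nth: "fps_nth inv_yx n = (- monomial [Y, X]) ^ n"
proof (induction n)
  case 0
  have "fps_nth (one_yx * inv_yx) 0 = 1" by (simp add: inv_yx_right)
  then show ?case by (simp add: one_yx_def)
next
  case (Suc n)
  have yx: "gen_y * gen_x = fps_const (monomial [Y, X])"
    by (simp add: gen_x_def gen_y_def mult_single plus_word_def)
  have "one_yx * inv_yx = inv_yx + fps_const (monomial [Y, X]) * (inv_yx * fps_X)"
    by (simp add: one_yx_def yx distrib_right mult.assoc fps_X_central)
  then have "fps_nth inv_yx (Suc n) + monomial [Y, X] * fps_nth inv_yx n = 0"
    using arg_cong [OF inv_yx_right, of "\<lambda>f. fps_nth f (Suc n)"] by simp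
  then show ?case
    by (simp add: Suc eq_neg_iff_add_eq_0)
qed

lemma op_term_mult: "op_term e t (f * g) n = (\<Sum>i\<le>n. op_term e t f i o\<^sub>L op_term e t g (n - i))"
proof -
  have "t ^ n *\<^sub>R (op_poly e (fps_nth f i) o\<^sub>L op_poly e (fps_nth g (n - i))) =
      op_term e t f i o\<^sub>L op_term e t g (n - i)" if "i \<le> n" for i
    using that by (simp add: op_term_def blinfun_compose_bilinear flip: power_add)
  then show ?thesis
    by (simp add: op_term_def fps_mult_nth op_poly_sum op_poly_mult scaleR_sum_right atMost_atLeast0)
qed

lemma op_term_add: "op_term e t (f + g) n = op_term e t f n + op_term e t g n"
  by (simp add: op_term_def op_poly_add scaleR_add_right)

lemma op_term_fps_const: "op_term e t (fps_const p) n = (if n = 0 then op_poly e p else 0)"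
  by (simp add: op_term_def)

lemma op_term_fps_X: "op_term e t fps_X n = (if n = 1 then t *\<^sub>R id_blinfun else 0)"
  by (simp add: op_term_def)

lemma summable_norm_single:
  fixes f :: "nat \<Rightarrow> 'a::real_normed_vector"
  assumes "\<And>n. n \<noteq> k \<Longrightarrow> f n = 0"
  shows "summable (\<lambda>n. norm (f n))"
  by (rule summable_finite [of "{k}"]) (auto simp: assms)

text \<open>Induction on the generation of \<open>alg_A\<close>. Smallness enters only for the
  inverse, whose terms are dominated by a geometric series; products are dominated by the Cauchy
  product of the norms.\<close>

lemma op_term_summable:
  fixes e :: "letter \<Rightarrow> 'a \<Rightarrow>\<^sub>L 'a::banach"
  assumes small: "\<bar>t\<bar> * norm (e Y o\<^sub>L e X) < 1" and "w \<in> alg_A"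
  shows "summable (\<lambda>i. norm (op_term e t w i))"
  using assms(2)
proof (induction rule: alg_A.induct)
  case (add f g)
  show ?case
    by (rule summable_comparison_test' [OF summable_add [OF add.IH]])
      (simp add: op_term_add norm_triangle_ineq)
next
  case (mult f g)
  have "summable (\<lambda>n. \<Sum>i\<le>n. norm (op_term e t f i) * norm (op_term e t g (n - i)))"
    by (rule summable_Cauchy_product) (use mult.IH in simp_all)
  moreover have "norm (op_term e t (f * g) n) \<le>
      (\<Sum>i\<le>n. norm (op_term e t f i) * norm (op_term e t g (n - i)))" for n
    unfolding op_term_mult by (intro sum_norm_le norm_blinfun_compose)
  ultimately show ?case
    by (intro summable_comparison_test' [of _ 0 "\<lambda>n. norm (op_term e t (f * g) n)"]) auto
next
  case inv
  have yx: "norm (op_poly e (- monomial [Y, X])) = norm (e Y o\<^sub>L e X)"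
    by (simp add: op_poly_uminus op_poly_single)
  have "norm (op_term e t inv_yx n) \<le> (\<bar>t\<bar> * norm (e Y o\<^sub>L e X)) ^ n" for n
    using op_poly_power_norm [of e "- monomial [Y, X]" n]
    by (simp add: op_term_def inv_yx_nth yx power_mult_distrib power_abs mult_left_mono)
  then show ?case
    using small by (intro summable_comparison_test' [OF summable_geometric]) auto
qed (auto simp: scalar_def gen_x_def gen_y_def op_term_fps_const op_term_fps_X
    intro: summable_norm_single [of 0] summable_norm_single [of 1])

lemma op_term_sums:
  fixes e :: "letter \<Rightarrow> 'a \<Rightarrow>\<^sub>L 'a::banach"
  assumes "\<bar>t\<bar> * norm (e Y o\<^sub>L e X) < 1" and "w \<in> alg_A"
  shows "op_term e t w sums op_series e t w"
  unfolding op_series_def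
  by (rule summable_sums [OF summable_norm_cancel [OF op_term_summable [OF assms]]])

lemma op_series_add:
  fixes e :: "letter \<Rightarrow> 'a \<Rightarrow>\<^sub>L 'a::banach"
  assumes "\<bar>t\<bar> * norm (e Y o\<^sub>L e X) < 1" and "f \<in> alg_A" and "g \<in> alg_A"
  shows "op_series e t (f + g) = op_series e t f + op_series e t g"
  using sums_add [OF op_term_sums [OF assms(1,2)] op_term_sums [OF assms(1,3)]]
  unfolding op_series_def by (intro sums_unique [symmetric]) (simp add: op_term_add [abs_def])

lemma op_series_mult:
  fixes e :: "letter \<Rightarrow> 'a \<Rightarrow>\<^sub>L 'a::banach"
  assumes "\<bar>t\<bar> * norm (e Y o\<^sub>L e X) < 1" and "f \<in> alg_A" and "g \<in> alg_A"
  shows "op_series e t (f * g) = op_series e t f o\<^sub>L op_series e t g"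
  using Cauchy_product_bounded_bilinear [OF bounded_bilinear_blinfun_compose
      op_term_summable [OF assms(1,2)] op_term_summable [OF assms(1,3)]]
  unfolding op_series_def by (intro sums_unique [symmetric]) (simp add: op_term_mult [abs_def])

lemma op_series_fps_const: "op_series e t (fps_const p) = op_poly e p"
proof -
  have "op_term e t (fps_const p) = (\<lambda>n. if n = 0 then op_poly e p else 0)"
    by (simp add: fun_eq_iff op_term_fps_const)
  then show ?thesis
    using sums_single [of 0 "\<lambda>_. op_poly e p"] by (simp add: op_series_def sums_iff)
qed

lemma op_series_fps_X: "op_series e t fps_X = t *\<^sub>R id_blinfun"
proof -
  have "op_term e t fps_X = (\<lambda>n. if n = 1 then t *\<^sub>R id_blinfun else 0)"
    by (simp add: fun_eq_iff op_term_fps_X)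
  then show ?thesis
    using sums_single [of 1 "\<lambda>_. t *\<^sub>R id_blinfun"] by (simp add: op_series_def sums_iff)
qed

lemma op_series_scalar: "op_series e t (scalar c) = of_rat c *\<^sub>R id_blinfun"
  by (simp add: scalar_def op_series_fps_const op_poly_single zero_word_def)

lemma op_series_gen:
  "op_series e t gen_x = e X" "op_series e t gen_y = e Y"
  by (simp_all add: gen_x_def gen_y_def op_series_fps_const op_poly_single)

lemma op_series_one_yx:
  fixes e :: "letter \<Rightarrow> 'a \<Rightarrow>\<^sub>L 'a::banach"
  assumes "\<bar>t\<bar> * norm (e Y o\<^sub>L e X) < 1"
  shows "op_series e t one_yx = id_blinfun + t *\<^sub>R (e Y o\<^sub>L e X)"
proof -
  have "1 \<in> alg_A" using alg_A.scalar [of 1] by simp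
  moreover have "op_series e t 1 = id_blinfun" using op_series_scalar [of e t 1] by simp
  ultimately show ?thesis
    by (simp add: one_yx_def op_series_add [OF assms] op_series_mult [OF assms] alg_A.intros
        op_series_gen op_series_fps_X blinfun_compose_bilinear)
qed

text \<open>Multiplicativity of the evaluation turns \<open>inv_yx * one_yx = 1\<close> into a left
  inverse of the operator \<open>1 + t Y X\<close>.\<close>

lemma op_series_inv_yx:
  fixes e :: "letter \<Rightarrow> 'a \<Rightarrow>\<^sub>L 'a::banach"
  assumes "\<bar>t\<bar> * norm (e Y o\<^sub>L e X) < 1"
  shows "op_series e t inv_yx (h + t *\<^sub>R e Y (e X h)) = h"
proof -
  have "op_series e t 1 = id_blinfun" using op_series_scalar [of e t 1] by simp
  then have "op_series e t inv_yx o\<^sub>L op_series e t one_yx = id_blinfun"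
    by (simp add: op_series_mult [OF assms, symmetric] alg_A.inv one_yx_in_A inv_yx_left)
  then have "(op_series e t inv_yx o\<^sub>L op_series e t one_yx) h = h"
    by simp
  then show ?thesis
    by (simp add: op_series_one_yx [OF assms] blinfun.add_left blinfun.scaleR_left)
qed

section \<open>Intertwining operators\<close>

lemma op_word_intertwine:
  fixes e :: "letter \<Rightarrow> 'a \<Rightarrow>\<^sub>L 'a::real_normed_vector"
    and d :: "letter \<Rightarrow> 'b \<Rightarrow>\<^sub>L 'b::real_normed_vector" and T :: "'a \<Rightarrow>\<^sub>L 'b"
  assumes "\<And>l h. T (e l h) = d l (T h)"
  shows "T (op_word e v h) = op_word d v (T h)"
  by (induction v arbitrary: h) (simp_all add: assms)

lemma op_poly_intertwine:
  fixes e :: "letter \<Rightarrow> 'a \<Rightarrow>\<^sub>L 'a::real_normed_vector"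
    and d :: "letter \<Rightarrow> 'b \<Rightarrow>\<^sub>L 'b::real_normed_vector" and T :: "'a \<Rightarrow>\<^sub>L 'b"
  assumes "\<And>l h. T (e l h) = d l (T h)"
  shows "T (op_poly e p h) = op_poly d p (T h)"
  by (induction p rule: nc_poly_induct)
    (simp_all add: op_poly_single op_poly_add op_word_intertwine [OF assms] blinfun.bilinear_simps)

text \<open>Continuity lets \<open>T\<close> pass through the series term by term. Later
  \<open>T\<close> is built from a commuting representation, or is an outer summation or the
  exchange of the two indices.\<close>

lemma op_series_intertwine:
  fixes e :: "letter \<Rightarrow> 'a \<Rightarrow>\<^sub>L 'a::banach" and d :: "letter \<Rightarrow> 'b \<Rightarrow>\<^sub>L 'b::banach"
    and T :: "'a \<Rightarrow>\<^sub>L 'b"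
  assumes e: "\<bar>t\<bar> * norm (e Y o\<^sub>L e X) < 1" and d: "\<bar>t\<bar> * norm (d Y o\<^sub>L d X) < 1"
    and w: "w \<in> alg_A" and T: "\<And>l h. T (e l h) = d l (T h)"
  shows "T (op_series e t w h) = op_series d t w (T h)"
proof -
  have "(\<lambda>i. T (op_term e t w i h)) sums T (op_series e t w h)"
    by (intro bounded_linear.sums [OF blinfun.bounded_linear_right]
        bounded_linear.sums [OF blinfun.bounded_linear_left] op_term_sums e w)
  moreover have "(\<lambda>i. op_term d t w i (T h)) sums op_series d t w (T h)"
    by (intro bounded_linear.sums [OF blinfun.bounded_linear_left] op_term_sums d w)
  then have "(\<lambda>i. T (op_term e t w i h)) sums op_series d t w (T h)"
    by (simp add: op_term_def op_poly_intertwine [where e = e and d = d and T = T, OF T]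
        blinfun.bilinear_simps)
  ultimately show ?thesis by (rule sums_unique2)
qed

text \<open>Two commuting representations that are intertwined by \<open>h\<close> on the generators are
  intertwined everywhere, because \<open>\<tau>\<close> reverses the order of factors.\<close>

lemma op_series_tau:
  fixes e d :: "letter \<Rightarrow> 'a \<Rightarrow>\<^sub>L 'a::banach"
  assumes e: "\<bar>t\<bar> * norm (e Y o\<^sub>L e X) < 1" and d: "\<bar>t\<bar> * norm (d Y o\<^sub>L d X) < 1"
    and comm: "\<And>k l h. e k (d l h) = d l (e k h)"
    and yx: "t *\<^sub>R e Y (e X h) = t *\<^sub>R d Y (d X h)"
    and y: "e Y h = d X (h + t *\<^sub>R d Y (d X h))"
    and y': "d Y h = e X (h + t *\<^sub>R e Y (e X h))"
    and "w \<in> alg_A"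
  shows "op_series e t w h = op_series d t (tau w) h"
  using assms(7)
proof (induction rule: alg_A.induct)
  case (scalar c)
  show ?case by (simp add: tau_scalar op_series_scalar)
next
  case x
  \<comment> \<open>By \<open>yx\<close> the bracket may be taken from \<open>d\<close>. Since
    \<open>e X\<close> commutes with \<open>d\<close>, it moves inside and the inverse of
    \<open>1 + t dY dX\<close> isolates \<open>e X h\<close>.\<close>
  have "d Y h = e X (h + t *\<^sub>R d Y (d X h))"
    by (simp only: y' yx)
  then have "d Y h = e X h + t *\<^sub>R d Y (d X (e X h))"
    by (simp add: blinfun.bilinear_simps comm)
  then have "op_series d t inv_yx (d Y h) = e X h"
    by (simp add: op_series_inv_yx [OF d])
  then show ?case
    by (simp add: tau_x op_series_mult [OF d] alg_A.intros op_series_gen)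
next
  case y
  show ?case
    by (simp add: tau_y op_series_mult [OF d] alg_A.intros one_yx_in_A op_series_gen
        op_series_one_yx [OF d] assms(5) blinfun.bilinear_simps)
next
  case lam
  show ?case by (simp add: tau_lambda op_series_fps_X blinfun.bilinear_simps)
next
  case inv
  \<comment> \<open>By \<open>yx\<close>, \<open>D h\<close> is also \<open>h + t dY dX h\<close>,
    so the \<open>d\<close>-inverse returns it to \<open>h\<close>. Since \<open>D\<close> commutes
    with \<open>d\<close>, it can then be moved outside, where the \<open>e\<close>-inverse cancels
    it.\<close>
  define D where "D = id_blinfun + t *\<^sub>R (e Y o\<^sub>L e X)"
  have D: "D (d l h) = d l (D h)" for l h
    by (simp add: D_def blinfun.bilinear_simps comm)
  have "op_series e t inv_yx h = op_series e t inv_yx (op_series d t inv_yx (D h))"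
    using op_series_inv_yx [OF d, of h] by (simp add: D_def yx blinfun.bilinear_simps)
  also have "\<dots> = op_series e t inv_yx (D (op_series d t inv_yx h))"
    by (simp add: op_series_intertwine [OF d d alg_A.inv D])
  also have "\<dots> = op_series d t inv_yx h"
    using op_series_inv_yx [OF e] by (simp add: D_def blinfun.add_left blinfun.scaleR_left)
  finally show ?case by (simp add: tau_inv_yx)
next
  case (add f g)
  then show ?case
    by (simp add: tau_add op_series_add e d tau_in_A blinfun.bilinear_simps)
next
  case (mult f g)
  \<comment> \<open>The evaluation of \<open>f\<close> under \<open>e\<close> must pass the
    evaluation of \<open>tau g\<close> under \<open>d\<close>; this exchange produces the reversed
    order of factors.\<close>
  have "op_series e t f (d l h) = d l (op_series e t f h)" for l h
    by (rule op_series_intertwine [OF e e mult.hyps(1), symmetric]) (simp add: comm)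
  note comm' = op_series_intertwine [OF d d tau_in_A [OF mult.hyps(2)] this]
  have "op_series e t (f * g) h = op_series e t f (op_series d t (tau g) h)"
    by (simp only: op_series_mult [OF e mult.hyps] blinfun_apply_blinfun_compose mult.IH)
  also have "\<dots> = op_series d t (tau g) (op_series d t (tau f) h)"
    by (simp only: comm' mult.IH)
  also have "\<dots> = op_series d t (tau (f * g)) h"
    by (simp only: tau_mult op_series_mult [OF d] tau_in_A mult.hyps blinfun_apply_blinfun_compose)
  finally show ?case .
qed

section \<open>Kernel operators on bounded double sequences\<close>

text \<open>Makes \<open>nat \<times> nat\<close> a metric space, so that the bounded continuous
  functions on it form a Banach space. Radius 1 isolates every point, so the metric induces the
  discrete topology.\<close>

instantiation nat :: metric_space
begin

definition dist_nat :: "nat \<Rightarrow> nat \<Rightarrow> real" where "dist m n = \<bar>real m - real n\<bar>"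

definition uniformity_nat :: "(nat \<times> nat) filter" where
  "uniformity = (INF e\<in>{0<..}. principal {(m, n :: nat). dist m n < e})"

instance
proof
  have eq: "n = m" if "dist m n < 1" for m n :: nat
    using that by (simp add: dist_nat_def)
  show "open U \<longleftrightarrow> (\<forall>m\<in>U. \<forall>\<^sub>F (m', n) in uniformity. m' = m \<longrightarrow> n \<in> U)" for U :: "nat set"
    unfolding uniformity_nat_def
    by (auto intro!: open_discrete eventually_INF1 [of 1] simp: eventually_principal dest: eq)
qed (auto simp: dist_nat_def uniformity_nat_def)

end

instance bcontfun :: (metric_space, banach) banach ..

text \<open>All bounded real double sequences with the supremum norm: on a discrete space continuity
  is automatic.\<close>

type_synonym dseq = "(nat \<times> nat) \<Rightarrow>\<^sub>C real"

lemma continuous_on_nat_prod: "continuous_on UNIV (f :: nat \<times> nat \<Rightarrow> 'a::topological_space)"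
proof -
  have "open S" for S :: "(nat \<times> nat) set"
  proof -
    have "open (\<Union>x\<in>S. {fst x} \<times> {snd x})"
      by (intro open_UN ballI open_Times open_discrete)
    then show ?thesis by simp
  qed
  then show ?thesis by (simp add: continuous_on_open_vimage)
qed

lemma apply_Bcontfun_nat_prod:
  fixes f :: "nat \<times> nat \<Rightarrow> real"
  assumes "\<And>x. \<bar>f x\<bar> \<le> c"
  shows "apply_bcontfun (Bcontfun f) = f"
  by (rule Bcontfun_inverse) (rule bcontfun_normI [of _ c], use assms in \<open>auto intro: continuous_on_nat_prod\<close>)

text \<open>A uniform bound on the absolute row sums bounds the operator norm with respect to the
  supremum norm.\<close>

definition bounded_kernel :: "(nat \<Rightarrow> nat \<Rightarrow> real) \<Rightarrow> real \<Rightarrow> bool" where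
  "bounded_kernel K B \<longleftrightarrow>
    (\<forall>m. (\<lambda>j. \<bar>K m j\<bar>) summable_on UNIV \<and> (\<Sum>\<^sub>\<infinity>j. \<bar>K m j\<bar>) \<le> B)"

lemma bounded_kernel_summable:
  assumes "bounded_kernel K B" and g: "\<And>j. \<bar>g j\<bar> \<le> c"
  shows "(\<lambda>j. K m j * g j) abs_summable_on UNIV"
    and "(\<Sum>\<^sub>\<infinity>j. \<bar>K m j * g j\<bar>) \<le> B * c"
    and "\<bar>\<Sum>\<^sub>\<infinity>j. K m j * g j\<bar> \<le> B * c"
proof -
  have K: "(\<lambda>j. \<bar>K m j\<bar>) summable_on UNIV" "(\<Sum>\<^sub>\<infinity>j. \<bar>K m j\<bar>) \<le> B"
    using assms by (auto simp: bounded_kernel_def)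
  have Kc: "(\<lambda>j. \<bar>K m j\<bar> * c) summable_on UNIV"
    using K by (intro summable_on_cmult_left)
  have "0 \<le> c" using g [of 0] by linarith
  show abs: "(\<lambda>j. K m j * g j) abs_summable_on UNIV"
    by (rule abs_summable_on_comparison_test' [OF Kc]) (simp add: abs_mult g mult_left_mono)
  have "(\<Sum>\<^sub>\<infinity>j. \<bar>K m j * g j\<bar>) \<le> (\<Sum>\<^sub>\<infinity>j. \<bar>K m j\<bar> * c)"
    by (rule infsum_mono) (use abs Kc in \<open>simp_all add: abs_mult g mult_left_mono\<close>)
  also have "\<dots> = (\<Sum>\<^sub>\<infinity>j. \<bar>K m j\<bar>) * c"
    by (rule infsum_cmult_left')
  also have "\<dots> \<le> B * c"
    using K \<open>0 \<le> c\<close> by (intro mult_right_mono)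
  finally show le: "(\<Sum>\<^sub>\<infinity>j. \<bar>K m j * g j\<bar>) \<le> B * c" .
  show "\<bar>\<Sum>\<^sub>\<infinity>j. K m j * g j\<bar> \<le> B * c"
    using norm_infsum_bound [OF abs] le by simp
qed

definition kernel_op :: "(nat \<Rightarrow> nat \<Rightarrow> real) \<Rightarrow> dseq \<Rightarrow>\<^sub>L dseq" where
  "kernel_op K = Blinfun (\<lambda>h. Bcontfun (\<lambda>(m, n). \<Sum>\<^sub>\<infinity>j. K m j * apply_bcontfun h (j, n)))"

lemma
  assumes K: "bounded_kernel K B"
  shows kernel_op_apply:
      "apply_bcontfun (kernel_op K h) (m, n) = (\<Sum>\<^sub>\<infinity>j. K m j * apply_bcontfun h (j, n))"
    and norm_kernel_op_le: "norm (kernel_op K) \<le> B"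
proof -
  define T where "T = (\<lambda>h :: dseq. Bcontfun (\<lambda>(m, n). \<Sum>\<^sub>\<infinity>j. K m j * apply_bcontfun h (j, n)))"
  have h: "\<bar>apply_bcontfun h x\<bar> \<le> norm h" for h :: dseq and x
    using norm_bounded [of h x] by simp
  note abs = bounded_kernel_summable [OF K, of "\<lambda>j. apply_bcontfun h (j, n)" for h n, OF h]
  note summable = abs_summable_summable [OF abs(1)]
  have T: "apply_bcontfun (T h) (m, n) = (\<Sum>\<^sub>\<infinity>j. K m j * apply_bcontfun h (j, n))" for h m n
    unfolding T_def by (subst apply_Bcontfun_nat_prod [of _ "B * norm h"]) (use abs(3) in auto)
  have le: "norm (T h) \<le> B * norm h" for h
    by (rule norm_bound) (use abs(3) in \<open>auto simp: T\<close>)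
  have "bounded_linear T"
  proof (rule bounded_linear_intro)
    show "T (g + h) = T g + T h" for g h
      by (rule bcontfun_eqI) (auto simp: T distrib_left infsum_add [OF summable summable])
    show "T (r *\<^sub>R h) = r *\<^sub>R T h" for r h
      by (rule bcontfun_eqI) (auto simp: T mult.left_commute infsum_cmult_right')
    show "norm (T h) \<le> norm h * B" for h
      using le by (simp add: mult.commute)
  qed
  then have app: "blinfun_apply (kernel_op K) = T"
    unfolding kernel_op_def T_def by (rule bounded_linear_Blinfun_apply)
  show "apply_bcontfun (kernel_op K h) (m, n) = (\<Sum>\<^sub>\<infinity>j. K m j * apply_bcontfun h (j, n))"
    by (simp add: app T)
  have "0 \<le> B"
    using K infsum_nonneg [of UNIV "\<lambda>j. \<bar>K 0 j\<bar>"] by (auto simp: bounded_kernel_def intro: order_trans)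
  then show "norm (kernel_op K) \<le> B"
    by (rule norm_blinfun_bound) (simp add: app le)
qed

definition swap_op :: "dseq \<Rightarrow>\<^sub>L dseq" where
  "swap_op = Blinfun (\<lambda>h. Bcontfun (\<lambda>(m, n). apply_bcontfun h (n, m)))"

lemma
  shows swap_op_apply: "apply_bcontfun (swap_op h) (m, n) = apply_bcontfun h (n, m)"
    and norm_swap_op_le: "norm swap_op \<le> 1"
proof -
  define T where "T = (\<lambda>h :: dseq. Bcontfun (\<lambda>(m, n). apply_bcontfun h (n, m)))"
  have h: "\<bar>apply_bcontfun h x\<bar> \<le> norm h" for h :: dseq and x
    using norm_bounded [of h x] by simp
  have T: "apply_bcontfun (T h) (m, n) = apply_bcontfun h (n, m)" for h m n
    unfolding T_def by (subst apply_Bcontfun_nat_prod [of _ "norm h"]) (use h in auto)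
  have le: "norm (T h) \<le> norm h" for h
    by (rule norm_bound) (use h in \<open>auto simp: T\<close>)
  have "bounded_linear T"
    by (rule bounded_linear_intro [where K = 1]) (auto intro: bcontfun_eqI simp: T le)
  then have app: "blinfun_apply swap_op = T"
    unfolding swap_op_def T_def by (rule bounded_linear_Blinfun_apply)
  show "apply_bcontfun (swap_op h) (m, n) = apply_bcontfun h (n, m)"
    by (simp add: app T)
  show "norm swap_op \<le> 1"
    by (rule norm_blinfun_bound) (simp_all add: app le)
qed

lemma swap_op_swap_op [simp]: "swap_op (swap_op h) = h"
  by (rule bcontfun_eqI) (auto simp: swap_op_apply)

text \<open>Carries an operator on the first index to the same operator on the second.\<close>

abbreviation conj_swap where "conj_swap T \<equiv> swap_op o\<^sub>L T o\<^sub>L swap_op"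

lemma norm_conj_swap_le: "norm (conj_swap T) \<le> norm T"
proof -
  have "norm (conj_swap T) \<le> norm (swap_op o\<^sub>L T) * norm swap_op"
    by (rule norm_blinfun_compose)
  also have "\<dots> \<le> norm (swap_op o\<^sub>L T)"
    by (simp add: norm_swap_op_le mult_left_le)
  also have "\<dots> \<le> norm swap_op * norm T"
    by (rule norm_blinfun_compose)
  also have "\<dots> \<le> norm T"
    by (simp add: norm_swap_op_le mult_left_le_one_le)
  finally show ?thesis .
qed

text \<open>Operators on different indices commute by Fubini: the rows of both kernels are
  absolutely summable and \<open>h\<close> is bounded, so the double family \<open>F\<close> is
  absolutely summable.\<close>

lemma kernel_op_commute:
  assumes K: "bounded_kernel K B" and K': "bounded_kernel K' B'"
  shows "kernel_op K (conj_swap (kernel_op K') h) = conj_swap (kernel_op K') (kernel_op K h)"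
proof (rule bcontfun_eqI, clarify)
  fix m n
  define F where "F = (\<lambda>j i. K m j * (K' n i * apply_bcontfun h (j, i)))"
  have h: "\<bar>apply_bcontfun h x\<bar> \<le> norm h" for x
    using norm_bounded [of h x] by simp
  note in1 = bounded_kernel_summable [OF K', of "\<lambda>i. apply_bcontfun h (j, i)" "norm h" for j, OF h]
  have "(\<lambda>j. K m j * (\<Sum>\<^sub>\<infinity>i. \<bar>K' n i * apply_bcontfun h (j, i)\<bar>)) abs_summable_on UNIV"
    by (rule bounded_kernel_summable(1) [OF K, of _ "B' * norm h"])
      (use in1(2) in \<open>simp add: infsum_nonneg\<close>)
  then have "(\<lambda>(j, i). F j i) abs_summable_on UNIV \<times> UNIV"
    using in1(1)
    by (subst abs_summable_on_Sigma_iff)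
      (simp add: F_def abs_mult infsum_cmult_right' summable_on_cmult_right infsum_nonneg)
  then have "(\<lambda>(j, i). F j i) summable_on UNIV \<times> UNIV"
    by (rule abs_summable_summable)
  then have "(\<Sum>\<^sub>\<infinity>j. \<Sum>\<^sub>\<infinity>i. F j i) = (\<Sum>\<^sub>\<infinity>i. \<Sum>\<^sub>\<infinity>j. F j i)"
    by (rule infsum_swap_banach)
  moreover have "F j i = K' n i * (K m j * apply_bcontfun h (j, i))" for i j
    by (simp add: F_def)
  then have "(\<Sum>\<^sub>\<infinity>j. F j i) = K' n i * (\<Sum>\<^sub>\<infinity>j. K m j * apply_bcontfun h (j, i))" for i
    by (simp only: infsum_cmult_right')
  moreover have "(\<Sum>\<^sub>\<infinity>i. F j i) = K m j * (\<Sum>\<^sub>\<infinity>i. K' n i * apply_bcontfun h (j, i))" for j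
    by (simp only: F_def infsum_cmult_right')
  ultimately show "apply_bcontfun (kernel_op K (conj_swap (kernel_op K') h)) (m, n) =
      apply_bcontfun (conj_swap (kernel_op K') (kernel_op K h)) (m, n)"
    by (simp add: kernel_op_apply [OF K] kernel_op_apply [OF K'] swap_op_apply)
qed

section \<open>The connected sum\<close>

text \<open>The q-Pochhammer symbol \<open>(t q; q)_n\<close>; the exponents start at 1.\<close>

definition qprod :: "real \<Rightarrow> real \<Rightarrow> nat \<Rightarrow> real" where
  "qprod q t n = (\<Prod>a<n. 1 - t * q ^ Suc a)"

lemma qprod_0 [simp]: "qprod q t 0 = 1"
  by (simp add: qprod_def)

lemma qprod_Suc: "qprod q t (Suc n) = qprod q t n * (1 - t * q ^ Suc n)"
  by (simp add: qprod_def)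

lemma qprod_factor_pos:
  fixes q t :: real
  assumes "0 < q" "q < 1" "0 \<le> t" "t * q < 1"
  shows "0 < 1 - t * q ^ Suc n"
proof -
  have "t * q * q ^ n \<le> t * q * 1"
    using assms by (intro mult_left_mono) (auto simp: power_le_one)
  then show ?thesis using assms by simp
qed

lemma qprod_pos:
  assumes "0 < q" "q < 1" "0 \<le> t" "t * q < 1"
  shows "0 < qprod q t n"
  unfolding qprod_def using qprod_factor_pos [OF assms] by (intro prod_pos) blast

text \<open>The deviations of the factors from 1 form a geometric series, so the product converges
  absolutely; as no factor vanishes, neither does its value.\<close>

lemma qprod_limit:
  assumes q: "0 < q" "q < 1" and t: "0 \<le> t" "t * q < 1"
  shows "\<exists>l>0. qprod q t \<longlonglongrightarrow> l"
proof -
  define f where "f = (\<lambda>a. 1 - t * q ^ Suc a)"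
  have "summable (\<lambda>a. t * q * q ^ a)"
    using q by (intro summable_mult summable_geometric) auto
  then have "summable (\<lambda>a. norm (f a - 1))"
    using q t by (simp add: f_def abs_mult mult.assoc)
  then have conv: "convergent_prod f"
    by (intro abs_convergent_prod_imp_convergent_prod summable_imp_abs_convergent_prod)
  have pos: "f a > 0" for a
    unfolding f_def using qprod_factor_pos assms by blast
  have "prodinf f \<noteq> 0"
    by (rule prodinf_nonzero [OF conv less_imp_neq [OF pos, symmetric]])
  have "(\<lambda>n. qprod q t (Suc n)) \<longlonglongrightarrow> prodinf f"
    using convergent_prod_LIMSEQ [OF conv]
    by (simp add: qprod_def f_def lessThan_Suc_atMost)
  then have lim: "qprod q t \<longlonglongrightarrow> prodinf f"
    by (rule LIMSEQ_imp_Suc)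
  then have "0 \<le> prodinf f"
    using qprod_pos [OF assms] by (intro LIMSEQ_le_const) (auto intro: less_imp_le)
  with lim \<open>prodinf f \<noteq> 0\<close> show ?thesis by force
qed

lemma infsum_greaterThan_nat:
  fixes f :: "nat \<Rightarrow> 'a::banach"
  assumes "f summable_on {m<..}"
  shows "infsum f {m<..} = f (Suc m) + infsum f {Suc m<..}"
proof -
  have "{m<..} = insert (Suc m) {Suc m<..}" by auto
  moreover have "f summable_on {Suc m<..}"
    by (rule summable_on_subset_banach [OF assms]) auto
  ultimately show ?thesis by (simp add: infsum_insert)
qed

lemma infsum_greaterThan_tendsto_0:
  fixes f :: "nat \<Rightarrow> real"
  assumes "f summable_on UNIV"
  shows "(\<lambda>m. infsum f {m<..}) \<longlonglongrightarrow> 0"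
proof -
  have sub: "f summable_on A" for A
    by (rule summable_on_subset_banach [OF assms]) auto
  have "infsum f {m<..} = infsum f UNIV - (\<Sum>i\<le>m. f i)" for m
  proof -
    have "infsum f UNIV = infsum f ({..m} \<union> {m<..})"
      by (rule arg_cong [of _ _ "infsum f"]) auto
    also have "\<dots> = infsum f {..m} + infsum f {m<..}"
      by (rule infsum_Un_disjoint) (auto intro: sub)
    finally show ?thesis by simp
  qed
  moreover have "(\<lambda>m. \<Sum>i\<le>m. f i) \<longlonglongrightarrow> infsum f UNIV"
    using has_sum_imp_sums [OF has_sum_infsum [OF assms]] by (simp add: sums_def_le)
  then have "(\<lambda>m. infsum f UNIV - (\<Sum>i\<le>m. f i)) \<longlonglongrightarrow> infsum f UNIV - infsum f UNIV"
    by (intro tendsto_intros)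
  ultimately show ?thesis by simp
qed

lemma const_if_Suc_eq:
  fixes f :: "nat \<Rightarrow> 'a"
  assumes "\<And>m. f m = f (Suc m)"
  shows "f m = f n"
proof -
  have "f m = f 0" for m using assms by (induction m) metis+
  then show ?thesis by metis
qed

text \<open>The form in which telescoping is used below: an expression is shown to be invariant
  under a shift of \<open>m\<close> and is then read off at infinity.\<close>

lemma const_eq_limit:
  fixes f :: "nat \<Rightarrow> real"
  assumes "\<And>m. f m = f (Suc m)" and "f \<longlonglongrightarrow> l"
  shows "f m = l"
proof -
  have "f = (\<lambda>_. f m)" using const_if_Suc_eq [of f, OF assms(1)] by auto
  then have "f \<longlonglongrightarrow> f m" by (metis tendsto_const)
  then show ?thesis using assms(2) by (rule LIMSEQ_unique)
qed

section \<open>Weights and their estimates\<close>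

text \<open>Since \<open>(1 + q) / 2 < 1\<close>, the first smallness condition keeps the factors in
  the denominators away from 0 at positive indices. The second makes the Neumann series converge, as
  \<open>Y X\<close> has norm at most \<open>4 / (1 - q)^2\<close>.\<close>

locale connected_sum =
  fixes q \<xi> \<eta> :: real
  assumes q: "0 < q" "q < 1"
    and nonneg: "0 \<le> \<xi>" "0 \<le> \<eta>"
    and small: "(1 + (1 - q) * \<xi>) * (1 + (1 - q) * \<eta>) * q \<le> (1 + q) / 2"
    and small_prod: "\<xi> * \<eta> * 4 < (1 - q)\<^sup>2"
begin

text \<open>With this choice \<open>[m] - q^m \<xi>\<close> equals
  \<open>(1 - \<alpha> q^m) / (1 - q)\<close>; likewise for \<beta> and \<eta>.\<close>

definition \<alpha> where "\<alpha> = 1 + (1 - q) * \<xi>"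
definition \<beta> where "\<beta> = 1 + (1 - q) * \<eta>"

definition wx where "wx m = q ^ m / qbracket q m"
definition wy where
  "wy m = qbracket q m / ((qbracket q m - q ^ m * \<xi>) * (qbracket q m - q ^ m * \<eta>))"
definition wxy where
  "wxy m = q ^ m / ((qbracket q m - q ^ m * \<xi>) * (qbracket q m - q ^ m * \<eta>))"
text \<open>The reciprocal of \<open>wx\<close> at positive indices. Its value 0 at index 0 matters:
  it makes \<open>L m 0\<close> constant in \<open>m\<close>.\<close>

definition wx_inv where "wx_inv m = qbracket q m / q ^ m"

lemma alpha_beta: "1 \<le> \<alpha>" "1 \<le> \<beta>" "\<alpha> * \<beta> * q \<le> (1 + q) / 2"
  using q nonneg small by (simp_all add: \<alpha>_def \<beta>_def)

lemma alpha_beta_le: "\<alpha> \<le> \<alpha> * \<beta>" "\<beta> \<le> \<alpha> * \<beta>"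
  using alpha_beta by simp_all

lemma alpha_beta_q: "\<alpha> * q \<le> (1 + q) / 2" "\<beta> * q \<le> (1 + q) / 2"
  using alpha_beta alpha_beta_le q by (meson less_imp_le mult_right_mono order_trans)+

lemma params_ok: "0 \<le> \<alpha>" "0 \<le> \<beta>" "0 \<le> \<alpha> * \<beta>" "\<alpha> * q < 1" "\<beta> * q < 1" "\<alpha> * \<beta> * q < 1"
  using alpha_beta alpha_beta_q q by auto

lemma bracket_eq:
  "qbracket q m = (1 - q ^ m) / (1 - q)"
  "qbracket q m - q ^ m * \<xi> = (1 - \<alpha> * q ^ m) / (1 - q)"
  "qbracket q m - q ^ m * \<eta> = (1 - \<beta> * q ^ m) / (1 - q)"
  using q by (simp_all add: qbracket_def \<alpha>_def \<beta>_def field_simps)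

lemma w_eq:
  "wx m = (1 - q) * q ^ m / (1 - q ^ m)"
  "wy m = (1 - q) * (1 - q ^ m) / ((1 - \<alpha> * q ^ m) * (1 - \<beta> * q ^ m))"
  "wxy m = (1 - q)\<^sup>2 * q ^ m / ((1 - \<alpha> * q ^ m) * (1 - \<beta> * q ^ m))"
  "wx_inv m = (1 - q ^ m) / ((1 - q) * q ^ m)"
proof -
  show "wx m = (1 - q) * q ^ m / (1 - q ^ m)" "wx_inv m = (1 - q ^ m) / ((1 - q) * q ^ m)"
    using q by (simp_all add: wx_def wx_inv_def bracket_eq)
  show "wy m = (1 - q) * (1 - q ^ m) / ((1 - \<alpha> * q ^ m) * (1 - \<beta> * q ^ m))"
    "wxy m = (1 - q)\<^sup>2 * q ^ m / ((1 - \<alpha> * q ^ m) * (1 - \<beta> * q ^ m))"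
    unfolding wy_def wxy_def bracket_eq(2,3) unfolding bracket_eq(1) using q by (simp_all add: power2_eq_square)
qed

lemma factor_ge:
  assumes "0 < m"
  shows "(1 - q) / 2 \<le> 1 - \<alpha> * q ^ m" "(1 - q) / 2 \<le> 1 - \<beta> * q ^ m" "0 < 1 - \<alpha> * \<beta> * q ^ m"
    "q ^ m < 1" "1 - q \<le> 1 - q ^ m"
proof -
  have "q ^ m \<le> q ^ 1" using assms q by (intro power_decreasing) auto
  then have le: "q ^ m \<le> q" by simp
  show "(1 - q) / 2 \<le> 1 - \<alpha> * q ^ m" "(1 - q) / 2 \<le> 1 - \<beta> * q ^ m"
    using mult_left_mono [OF le params_ok(1)] mult_left_mono [OF le params_ok(2)] alpha_beta_q
    by (auto simp: field_simps)
  show "0 < 1 - \<alpha> * \<beta> * q ^ m"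
    using mult_left_mono [OF le params_ok(3)] params_ok by linarith
  show "q ^ m < 1" "1 - q \<le> 1 - q ^ m" using le q by auto
qed

lemma factor_pos:
  assumes "0 < m"
  shows "0 < 1 - \<alpha> * q ^ m" "0 < 1 - \<beta> * q ^ m"
  using less_le_trans [OF _ factor_ge(1) [OF assms], of 0]
    less_le_trans [OF _ factor_ge(2) [OF assms], of 0] q by simp_all

lemma w_bounds:
  assumes "0 < m"
  shows "0 \<le> wx m" "wx m \<le> q ^ m" "0 \<le> wy m" "wy m \<le> 4 / (1 - q)" "0 \<le> wxy m" "wxy m \<le> 4 * q ^ m"
proof -
  note ge = factor_ge [OF assms] and pos = factor_pos [OF assms]
  show "0 \<le> wx m" "0 \<le> wy m" "0 \<le> wxy m"
    unfolding w_eq using ge pos q by simp_all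
  show "wx m \<le> q ^ m"
    unfolding w_eq using ge q by (simp add: divide_le_eq mult.commute mult_left_mono)
  have "(1 - q) / 2 * ((1 - q) / 2) \<le> (1 - \<alpha> * q ^ m) * (1 - \<beta> * q ^ m)"
    using ge q by (intro mult_mono) auto
  then have den: "(1 - q)\<^sup>2 \<le> 4 * ((1 - \<alpha> * q ^ m) * (1 - \<beta> * q ^ m))"
    by (simp add: power2_eq_square field_simps)
  have "wxy m * 1 \<le> 4 * q ^ m"
    unfolding w_eq using den pos q by (simp add: divide_le_eq mult.commute mult.left_commute mult_left_mono)
  then show "wxy m \<le> 4 * q ^ m" by simp
  have "(1 - q) * (1 - q) * (1 - q ^ m) \<le> (1 - q) * (1 - q) * 1"
    using q by (intro mult_left_mono) auto
  then have "(1 - q) * ((1 - q) * (1 - q ^ m)) \<le> 4 * ((1 - \<alpha> * q ^ m) * (1 - \<beta> * q ^ m))"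
    using den by (simp add: power2_eq_square mult.assoc)
  then show "wy m \<le> 4 / (1 - q)"
    unfolding w_eq using pos q by (simp add: divide_le_eq le_divide_eq mult.commute mult.left_commute)
qed

lemma lambda_eq: "\<xi> * \<eta> * (1 - q)\<^sup>2 = (\<alpha> - 1) * (\<beta> - 1)"
  by (simp add: \<alpha>_def \<beta>_def power2_eq_square)

text \<open>The right-hand side is the quotient of \<open>conn\<close> at \<open>(m - 1, n)\<close>
  and \<open>(m, n)\<close>; the left-hand side splits it into weights. After
  \<open>lambda_eq\<close> it is a rational identity in \<open>u = q^m\<close> and
  \<open>v = q^n\<close>.\<close>

lemma ratio_eq:
  assumes "0 < m"
  shows "1 - \<xi> * \<eta> * wxy m + wy m * wx_inv n =
    (1 - q ^ m) * (1 - \<alpha> * \<beta> * q ^ (m + n)) / (q ^ n * ((1 - \<alpha> * q ^ m) * (1 - \<beta> * q ^ m)))"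
proof -
  have *: "1 - (a - 1) * (b - 1) * u / ((1 - a * u) * (1 - b * u)) +
      (1 - u) * (1 - v) / (v * ((1 - a * u) * (1 - b * u))) =
      (1 - u) * (1 - a * b * (u * v)) / (v * ((1 - a * u) * (1 - b * u)))"
    if "v \<noteq> 0" "1 - a * u \<noteq> 0" "1 - b * u \<noteq> 0" for a b u v :: real
  proof -
    define S where "S = (1 - a * u) * (1 - b * u)"
    have "S \<noteq> 0" using that by (simp add: S_def)
    then have "1 - (a - 1) * (b - 1) * u / S + (1 - u) * (1 - v) / (v * S) =
        (v * S - (a - 1) * (b - 1) * u * v + (1 - u) * (1 - v)) / (v * S)"
      using that by (simp add: field_simps)
    also have "v * S - (a - 1) * (b - 1) * u * v + (1 - u) * (1 - v) =
        (1 - u) * (1 - a * b * (u * v))"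
      by (simp add: S_def algebra_simps)
    finally show ?thesis by (simp add: S_def)
  qed
  have "\<xi> * \<eta> * wxy m = (\<alpha> - 1) * (\<beta> - 1) * q ^ m / ((1 - \<alpha> * q ^ m) * (1 - \<beta> * q ^ m))"
    unfolding w_eq by (simp add: lambda_eq [symmetric])
  moreover have "wy m * wx_inv n =
      (1 - q ^ m) * (1 - q ^ n) / (q ^ n * ((1 - \<alpha> * q ^ m) * (1 - \<beta> * q ^ m)))"
    unfolding w_eq using q by simp
  ultimately show ?thesis
    using * [of "q ^ n" \<alpha> "q ^ m" \<beta>] factor_pos [OF assms] q
    by (simp add: power_add)
qed

section \<open>The connector and its limits\<close>

definition F where "F m = qprod q \<alpha> m * qprod q \<beta> m / qprod q 1 m"
definition G where "G m = qprod q (\<alpha> * \<beta>) m"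

lemma F_0 [simp]: "F 0 = 1"
  by (simp add: F_def)

lemma F_Suc: "F (Suc m) = F m * ((1 - \<alpha> * q ^ Suc m) * (1 - \<beta> * q ^ Suc m) / (1 - q ^ Suc m))"
  by (simp add: F_def qprod_Suc)

lemma G_Suc: "G (Suc m) = G m * (1 - \<alpha> * \<beta> * q ^ Suc m)"
  by (simp add: G_def qprod_Suc)

lemma F_G_limit: "\<exists>f g. 0 < f \<and> 0 < g \<and> F \<longlonglongrightarrow> f \<and> G \<longlonglongrightarrow> g"
proof -
  obtain a b c g where "0 < a" "0 < b" "0 < c" "0 < g"
    and lim: "qprod q \<alpha> \<longlonglongrightarrow> a" "qprod q \<beta> \<longlonglongrightarrow> b" "qprod q 1 \<longlonglongrightarrow> c" "qprod q (\<alpha> * \<beta>) \<longlonglongrightarrow> g"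
    using qprod_limit [OF q params_ok(1,4)] qprod_limit [OF q params_ok(2,5)]
      qprod_limit [OF q params_ok(3,6)] qprod_limit [OF q, of 1] q by auto
  have "F \<longlonglongrightarrow> a * b / c"
    unfolding F_def using lim \<open>0 < c\<close> by (intro tendsto_intros) auto
  moreover have "G \<longlonglongrightarrow> g" unfolding G_def by fact
  ultimately show ?thesis
    using \<open>0 < a\<close> \<open>0 < b\<close> \<open>0 < c\<close> \<open>0 < g\<close> by (metis divide_pos_pos mult_pos_pos)
qed

text \<open>The constant in front normalises the limit of \<open>conn m 0\<close> to 1.\<close>

definition conn where
  "conn m n = lim G / lim F * q ^ (m * n) * F m * F n / G (m + n)"

lemma conn_commute: "conn m n = conn n m"
  by (simp add: conn_def mult.commute add.commute)

lemma conn_bound: "\<exists>B>0. \<forall>m n. \<bar>conn m n\<bar> \<le> B * q ^ (m * n)"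
proof -
  obtain f g where "0 < f" "0 < g" and lim: "F \<longlonglongrightarrow> f" "G \<longlonglongrightarrow> g"
    using F_G_limit by blast
  have "(\<lambda>n. 1 / G n) \<longlonglongrightarrow> 1 / g"
    using lim \<open>0 < g\<close> by (intro tendsto_intros) auto
  then have "Bseq (\<lambda>n. 1 / G n)" and "Bseq F"
    using lim by (auto intro: convergent_imp_Bseq convergentI)
  then obtain A B where A: "0 < A" "\<And>n. \<bar>F n\<bar> \<le> A" and B: "0 < B" "\<And>n. \<bar>1 / G n\<bar> \<le> B"
    unfolding Bseq_def by (metis real_norm_def)
  have "\<bar>conn m n\<bar> \<le> g / f * A * A * B * q ^ (m * n)" for m n
  proof -
    have "\<bar>conn m n\<bar> = g / f * \<bar>F m\<bar> * \<bar>F n\<bar> * \<bar>1 / G (m + n)\<bar> * q ^ (m * n)"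
      using lim [THEN limI] \<open>0 < f\<close> \<open>0 < g\<close> q by (simp add: conn_def abs_mult)
    also have "\<dots> \<le> g / f * A * A * B * q ^ (m * n)"
      using A B \<open>0 < f\<close> \<open>0 < g\<close> q by (intro mult_mono) auto
    finally show ?thesis .
  qed
  then show ?thesis
    using A B \<open>0 < f\<close> \<open>0 < g\<close> by (intro exI [of _ "g / f * A * A * B"]) auto
qed

text \<open>For \<open>n = 0\<close> this is the normalisation; for positive \<open>n\<close> the
  factor \<open>q^(m n)\<close> decays while the others stay bounded. These are the boundary values
  for telescoping.\<close>

lemma conn_tendsto: "(\<lambda>m. conn m n) \<longlonglongrightarrow> of_bool (n = 0)"
proof (cases "n = 0")
  case True
  obtain f g where "0 < f" "0 < g" and lim: "F \<longlonglongrightarrow> f" "G \<longlonglongrightarrow> g"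
    using F_G_limit by blast
  have "(\<lambda>m. g / f * F m / G m) \<longlonglongrightarrow> g / f * f / g"
    using lim \<open>0 < g\<close> by (intro tendsto_intros) auto
  then show ?thesis
    using True lim [THEN limI] \<open>0 < f\<close> \<open>0 < g\<close> by (simp add: conn_def)
next
  case False
  obtain B where "0 < B" and B: "\<bar>conn m n\<bar> \<le> B * q ^ (m * n)" for m n
    using conn_bound by blast
  have "norm (conn m n) \<le> B * q ^ m" for m
  proof -
    have "q ^ (m * n) \<le> q ^ m" using False q by (intro power_decreasing) auto
    then show ?thesis
      using B [of m n] \<open>0 < B\<close> by (auto intro: order_trans mult_left_mono)
  qed
  moreover have "(\<lambda>m. B * q ^ m) \<longlonglongrightarrow> B * 0"
    using q by (intro tendsto_intros LIMSEQ_power_zero) auto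
  ultimately have "(\<lambda>m. conn m n) \<longlonglongrightarrow> 0"
    by (intro Lim_null_comparison [of "\<lambda>m. conn m n" "\<lambda>m. B * q ^ m"]) simp_all
  then show ?thesis using False by simp
qed

lemma conn_Suc:
  "conn m n = conn (Suc m) n * (1 - \<xi> * \<eta> * wxy (Suc m) + wy (Suc m) * wx_inv n)"
proof -
  have *: "k * w * f * h / g = k * (v * w) * (f * (a * b / u)) * h / (g * d) * (u * d / (v * (a * b)))"
    if "v \<noteq> 0" "a \<noteq> 0" "b \<noteq> 0" "u \<noteq> 0" "d \<noteq> 0" for k w f h g v a b u d :: real
    using that by simp
  have "0 < 1 - \<alpha> * \<beta> * q ^ Suc (m + n)" "0 < 1 - q ^ Suc m"
    using factor_ge(3) [of "Suc (m + n)"] factor_ge(4) [of "Suc m"] by simp_all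
  with factor_pos [of "Suc m"] show ?thesis
    unfolding ratio_eq [OF zero_less_Suc] conn_def F_Suc add_Suc G_Suc mult_Suc power_add [of q n]
    using q by (intro *) simp_all
qed

lemma conn_Suc':
  "conn m n = conn m (Suc n) * (1 - \<xi> * \<eta> * wxy (Suc n) + wy (Suc n) * wx_inv m)"
  using conn_Suc [of n m] by (simp add: conn_commute)

section \<open>Telescoping sums and the symmetry of \<open>L\<close>\<close>

lemma summable_on_geometric: "(\<lambda>m. c * q ^ m) summable_on A"
proof -
  have "summable (\<lambda>m. norm (c * q ^ m))"
    using q by (simp add: abs_mult summable_mult)
  then show ?thesis
    by (rule summable_on_subset_banach [OF norm_summable_imp_summable_on]) simp
qed

lemma abs_summable_geometric_bound:
  assumes "\<And>m. m \<in> A \<Longrightarrow> \<bar>f m\<bar> \<le> c * q ^ m"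
  shows "f abs_summable_on A"
  by (rule abs_summable_on_comparison_test' [OF summable_on_geometric])
    (use assms in auto)

lemma wxy_conn_summable: "(\<lambda>a. wxy a * conn a n) summable_on A"
proof -
  obtain B where "0 < B" and B: "\<bar>conn m n\<bar> \<le> B * q ^ (m * n)" for m n
    using conn_bound by blast
  have "\<bar>wxy a * conn a n\<bar> \<le> 4 * B * q ^ a" if "0 < a" for a
  proof -
    have "\<bar>conn a n\<bar> \<le> B"
      using B [of a n] \<open>0 < B\<close> q power_le_one [of q "a * n"]
      by (meson less_imp_le mult_left_le order_trans)
    then have "\<bar>wxy a\<bar> * \<bar>conn a n\<bar> \<le> 4 * q ^ a * B"
      using w_bounds [OF that] q by (intro mult_mono) auto
    then show ?thesis by (simp add: abs_mult mult.commute mult.left_commute)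
  qed
  then have "(\<lambda>a. wxy a * conn a n) abs_summable_on {0<..}"
    by (intro abs_summable_geometric_bound) auto
  then have "(\<lambda>a. wxy a * conn a n) summable_on {0<..}"
    by (rule abs_summable_summable)
  \<comment> \<open>The estimates hold at positive indices only; the single index 0 does not affect
    summability.\<close>
  then have "(\<lambda>a. wxy a * conn a n) summable_on insert 0 {0<..}"
    by (simp only: summable_on_insert_iff)
  then show ?thesis by (rule summable_on_subset_banach) auto
qed

text \<open>Unlike \<open>wxy\<close>, the weight \<open>wy\<close> is merely bounded; the decay
  comes from \<open>q^(a n)\<close>, hence the condition on \<open>n\<close>.\<close>

lemma wy_conn_summable: "0 < n \<Longrightarrow> (\<lambda>a. wy a * conn a n) summable_on {m<..}"
proof -
  assume n: "0 < n"
  obtain B where "0 < B" and B: "\<bar>conn m n\<bar> \<le> B * q ^ (m * n)" for m n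
    using conn_bound by blast
  have "\<bar>wy a * conn a n\<bar> \<le> 4 / (1 - q) * B * q ^ a" if "0 < a" for a
  proof -
    have "q ^ (a * n) \<le> q ^ a" using n q by (intro power_decreasing) auto
    then have "\<bar>conn a n\<bar> \<le> B * q ^ a"
      using B [of a n] \<open>0 < B\<close> by (auto intro: order_trans mult_left_mono)
    then have "\<bar>wy a\<bar> * \<bar>conn a n\<bar> \<le> 4 / (1 - q) * (B * q ^ a)"
      using w_bounds [OF that] q by (intro mult_mono) auto
    then show ?thesis by (simp add: abs_mult mult.assoc)
  qed
  then show ?thesis
    by (intro abs_summable_summable [OF abs_summable_geometric_bound [where c = "4 / (1 - q) * B"]])
      simp
qed

text \<open>\<open>L\<close> is the function \<open>D\<^sub>m C\<close> for the kernel \<open>C = conn\<close>.\<close>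

definition L where
  "L m n = conn m n + \<xi> * \<eta> * (\<Sum>\<^sub>\<infinity>a\<in>{m<..}. wxy a * conn a n)"

text \<open>The summand that leaves the tail cancels the \<open>wxy\<close> term of
  \<open>conn_Suc\<close>; only the \<open>wy\<close> term survives.\<close>

lemma L_diff: "L m n - L (Suc m) n = wy (Suc m) * wx_inv n * conn (Suc m) n"
proof -
  have "L m n - L (Suc m) n =
      conn m n - conn (Suc m) n + \<xi> * \<eta> * (wxy (Suc m) * conn (Suc m) n)"
    by (simp add: L_def infsum_greaterThan_nat [OF wxy_conn_summable, of n m] distrib_left)
  then show ?thesis
    by (simp add: conn_Suc [of m n] algebra_simps)
qed

lemma L_tendsto: "(\<lambda>m. L m n) \<longlonglongrightarrow> of_bool (n = 0)"
proof -
  have "(\<lambda>m. L m n) \<longlonglongrightarrow> of_bool (n = 0) + \<xi> * \<eta> * 0"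
    unfolding L_def
    by (intro tendsto_intros conn_tendsto infsum_greaterThan_tendsto_0 wxy_conn_summable)
  then show ?thesis by simp
qed

text \<open>\<open>wx_inv 0 = 0\<close> kills the difference in \<open>L_diff\<close>, so the value
  is the limit.\<close>

lemma L_0: "L m 0 = 1"
  using const_eq_limit [OF _ L_tendsto, of 0 m] L_diff [of _ 0] by (simp add: wx_inv_def qbracket_def)

text \<open>By \<open>L_diff\<close> the difference of the two sides does not depend on
  \<open>m\<close>, and for positive \<open>n\<close> it tends to 0.\<close>

lemma L_eq:
  assumes "0 < n"
  shows "L m n = wx_inv n * (\<Sum>\<^sub>\<infinity>a\<in>{m<..}. wy a * conn a n)"
proof -
  define f where "f m = L m n - wx_inv n * (\<Sum>\<^sub>\<infinity>a\<in>{m<..}. wy a * conn a n)" for m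
  have "f m = f (Suc m)" for m
    using L_diff [of m n]
    by (simp add: f_def infsum_greaterThan_nat [OF wy_conn_summable [OF assms], of m] algebra_simps)
  moreover have "(\<lambda>a. wy a * conn a n) summable_on insert 0 {0<..}"
    using wy_conn_summable [OF assms] by (subst summable_on_insert_iff)
  then have "(\<lambda>a. wy a * conn a n) summable_on UNIV"
    by (rule summable_on_subset_banach) auto
  then have "f \<longlonglongrightarrow> of_bool (n = 0) - wx_inv n * 0"
    unfolding f_def by (intro tendsto_intros L_tendsto infsum_greaterThan_tendsto_0)
  ultimately have "f m = of_bool (n = 0) - wx_inv n * 0"
    by (rule const_eq_limit)
  then show ?thesis using assms by (simp add: f_def)
qed

text \<open>The coefficient of \<open>conn (Suc m') (Suc n')\<close> in the shift difference of
  \<open>H\<close> in \<open>L_diff'\<close>. In \<open>u\<close> and \<open>v\<close> the four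
  products share the factor \<open>W\<close>, and the remaining polynomial vanishes.\<close>

lemma weight_identity:
  "wy (Suc m') * wx_inv n' * (1 - \<xi> * \<eta> * wxy (Suc n') + wy (Suc n') * wx_inv (Suc m'))
      - wy (Suc m') * wx_inv (Suc n')
      - wy (Suc n') * wx_inv m' * (1 - \<xi> * \<eta> * wxy (Suc m') + wy (Suc m') * wx_inv (Suc n'))
      + wy (Suc n') * wx_inv (Suc m') = 0"
proof -
  define u where "u = q ^ Suc m'"
  define v where "v = q ^ Suc n'"
  define U where "U = (1 - \<alpha> * u) * (1 - \<beta> * u)"
  define V where "V = (1 - \<alpha> * v) * (1 - \<beta> * v)"
  define W where "W = (1 - u) * (1 - v) / (U * V * (u * v))"
  have nz: "u \<noteq> 0" "v \<noteq> 0" "U \<noteq> 0" "V \<noteq> 0" "1 - q \<noteq> 0"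
    using q factor_pos [of "Suc m'"] factor_pos [of "Suc n'"] by (auto simp: u_def v_def U_def V_def)
  \<comment> \<open>Here \<open>q^m'\<close> is \<open>u / q\<close>, which brings in the factors
    \<open>q - u\<close> and \<open>q - v\<close>.\<close>
  have u': "wx_inv m' = (q - u) / ((1 - q) * u)" and v': "wx_inv n' = (q - v) / ((1 - q) * v)"
    using q by (simp_all add: w_eq u_def v_def field_simps)
  have wy: "wy (Suc m') = (1 - q) * (1 - u) / U" "wy (Suc n') = (1 - q) * (1 - v) / V"
    by (simp_all add: w_eq u_def v_def U_def V_def)
  have xi: "wx_inv (Suc m') = (1 - u) / ((1 - q) * u)" "wx_inv (Suc n') = (1 - v) / ((1 - q) * v)"
    by (simp_all add: w_eq u_def v_def)
  have r: "1 - \<xi> * \<eta> * wxy (Suc n') + wy (Suc n') * wx_inv (Suc m') =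
      (1 - v) * (1 - \<alpha> * \<beta> * (u * v)) / (u * V)"
    "1 - \<xi> * \<eta> * wxy (Suc m') + wy (Suc m') * wx_inv (Suc n') =
      (1 - u) * (1 - \<alpha> * \<beta> * (u * v)) / (v * U)"
    unfolding ratio_eq [OF zero_less_Suc] power_add
    by (simp_all add: u_def v_def U_def V_def mult.commute)
  have "wy (Suc m') * wx_inv n' * (1 - \<xi> * \<eta> * wxy (Suc n') + wy (Suc n') * wx_inv (Suc m')) =
      W * ((q - v) * (1 - \<alpha> * \<beta> * (u * v)))"
    unfolding r wy(1) v' W_def using nz by (simp add: ac_simps)
  moreover have "wy (Suc n') * wx_inv m' *
      (1 - \<xi> * \<eta> * wxy (Suc m') + wy (Suc m') * wx_inv (Suc n')) =
      W * ((q - u) * (1 - \<alpha> * \<beta> * (u * v)))"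
    unfolding r wy(2) u' W_def using nz by (simp add: ac_simps)
  moreover have "wy (Suc m') * wx_inv (Suc n') = W * (u * V)"
    "wy (Suc n') * wx_inv (Suc m') = W * (v * U)"
    unfolding wy xi W_def using nz by (simp_all add: ac_simps)
  moreover have "(q - v) * (1 - \<alpha> * \<beta> * (u * v)) - u * V - (q - u) * (1 - \<alpha> * \<beta> * (u * v)) + v * U = 0"
    by (simp add: U_def V_def algebra_simps)
  ultimately show ?thesis
    by (simp only: right_diff_distrib [symmetric] distrib_left [symmetric] mult_zero_right)
qed

text \<open>This would be \<open>L_diff\<close> with the variables exchanged if \<open>L\<close>
  were known to be symmetric. Instead the defect \<open>H\<close> is shown to be constant in
  \<open>m\<close> with limit 0.\<close>

lemma L_diff': "L m n - L m (Suc n) = wy (Suc n) * wx_inv m * conn m (Suc n)"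
proof -
  define H where "H m = L m n - L m (Suc n) - wy (Suc n) * wx_inv m * conn m (Suc n)" for m
  have "H m = H (Suc m)" for m
  proof -
    have "H m - H (Suc m) =
        wy (Suc m) * wx_inv n * conn (Suc m) n - wy (Suc m) * wx_inv (Suc n) * conn (Suc m) (Suc n)
        - wy (Suc n) * wx_inv m * conn m (Suc n)
        + wy (Suc n) * wx_inv (Suc m) * conn (Suc m) (Suc n)"
      using L_diff [of m n] L_diff [of m "Suc n"] by (simp add: H_def)
    also have "\<dots> = conn (Suc m) (Suc n) * 0"
      unfolding weight_identity [of m n, symmetric] conn_Suc' [of "Suc m" n] conn_Suc [of m "Suc n"]
      by (simp only: algebra_simps)
    finally show ?thesis by simp
  qed
  moreover have "H \<longlonglongrightarrow> 0"
  proof -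
    \<comment> \<open>The factor \<open>wx_inv m\<close> is unbounded; \<open>conn_Suc'\<close>
      trades its product with \<open>conn\<close> for terms with known limits.\<close>
    have H: "H m = L m n - L m (Suc n) - conn m n + (1 - \<xi> * \<eta> * wxy (Suc n)) * conn m (Suc n)" for m
      by (simp add: H_def conn_Suc' [of m n] algebra_simps)
    have "H \<longlonglongrightarrow> of_bool (n = 0) - of_bool (Suc n = 0) - of_bool (n = 0)
        + (1 - \<xi> * \<eta> * wxy (Suc n)) * of_bool (Suc n = 0)"
      unfolding H by (intro tendsto_intros L_tendsto conn_tendsto)
    then show ?thesis by simp
  qed
  ultimately have "H m = 0" by (rule const_eq_limit)
  then show ?thesis by (simp add: H_def)
qed

text \<open>By the two difference equations, \<open>L m n - L n m\<close> depends neither on \<open>m\<close> nor on \<open>n\<close>.\<close>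

lemma L_commute: "L m n = L n m"
proof -
  define d where "d m n = L m n - L n m" for m n
  have "d m n = d m (Suc n)" for m n
    using L_diff [of n m] L_diff' [of m n] by (simp add: d_def conn_commute)
  then have d: "d m n = d m n'" for m n n'
    by (rule const_if_Suc_eq)
  have "d m n = - d n m" by (simp add: d_def)
  also have "\<dots> = - d n n" using d [of n m n] by simp
  also have "\<dots> = 0" by (simp add: d_def)
  finally show ?thesis by (simp add: d_def)
qed

text \<open>\<open>L 0 m = L m 0 = 1\<close> by symmetry; expanding \<open>L 0 m\<close> by
  \<open>L_eq\<close> gives the sum.\<close>

lemma wx_eq_sum:
  assumes "0 < m"
  shows "wx m = (\<Sum>\<^sub>\<infinity>n\<in>{0<..}. wy n * conn m n)"
proof -
  have "wx_inv m * (\<Sum>\<^sub>\<infinity>n\<in>{0<..}. wy n * conn n m) = 1"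
    using L_eq [OF assms, of 0] L_commute [of 0 m] L_0 by simp
  then have "wx_inv m * (\<Sum>\<^sub>\<infinity>n\<in>{0<..}. wy n * conn m n) = 1"
    by (simp only: conn_commute [of m])
  moreover have "wx m * wx_inv m = 1"
    using factor_ge [OF assms] q by (simp add: w_eq)
  ultimately show ?thesis
    by (metis mult.assoc mult.right_neutral mult_1)
qed

lemma sum_wy_conn:
  assumes "0 < n"
  shows "(\<Sum>\<^sub>\<infinity>a\<in>{m<..}. wy a * conn a n) = wx n * L m n"
proof -
  have "wx n * wx_inv n = 1"
    using factor_ge [OF assms] q by (simp add: w_eq)
  then show ?thesis by (simp add: L_eq [OF assms] mult.assoc [symmetric])
qed

end

context connected_sum
begin

section \<open>The defining series as iterated sums\<close>

fun act :: "letter \<Rightarrow> (nat \<Rightarrow> real) \<Rightarrow> nat \<Rightarrow> real" where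
  "act X f m = wx m * f m"
| "act Y f m = (\<Sum>\<^sub>\<infinity>a\<in>{m<..}. wy a * f a)"

text \<open>The variable lower bound allows induction by splitting off the smallest entry.\<close>

definition tuples_above :: "nat \<Rightarrow> nat \<Rightarrow> nat list set" where
  "tuples_above m r = {ms. length ms = r \<and> sorted_wrt (<) ms \<and> (\<forall>x\<in>set ms. m < x)}"

lemma tuples_above_0: "tuples_above 0 r = increasing_tuples r"
  by (simp add: tuples_above_def increasing_tuples_def)

lemma tuples_above_Cons: "a # ns \<in> tuples_above m (Suc r) \<longleftrightarrow> m < a \<and> ns \<in> tuples_above a r"
  by (auto simp: tuples_above_def intro: less_trans)

lemma act_X_funpow: "(act X ^^ k) f m = wx m ^ k * f m"
  by (induction k arbitrary: m) simp_all

text \<open>Splitting \<open>[a]^(k-2)\<close> as \<open>[a]^(k-1) / [a]\<close> puts one bracket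
  into \<open>wy\<close> and the rest into \<open>wx^(k-1)\<close>; this also covers
  \<open>k = 1\<close>.\<close>

lemma O_term_Cons:
  assumes "1 \<le> k" "0 < a"
  shows "O_term q \<xi> \<eta> (k # ks) (a # ms) = wy a * wx a ^ (k - 1) * O_term q \<xi> \<eta> ks ms"
proof -
  have "qbracket q a \<noteq> 0"
    using factor_ge [OF assms(2)] q by (simp add: qbracket_def)
  then have "qbracket q a powi (int (k - 1) - int 1) = qbracket q a ^ (k - 1) / qbracket q a ^ 1"
    by (subst power_int_diff) simp_all
  moreover have "int (k - 1) - int 1 = int k - 2" using assms by simp
  ultimately have "qbracket q a powi (int k - 2) = qbracket q a ^ (k - 1) / qbracket q a"
    by (simp only: power_one_right)
  then show ?thesis
    by (simp add: O_term_def wx_def wy_def prod.lessThan_Suc_shift power_divide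
        power_mult [symmetric] mult.commute [of a] del: prod.lessThan_Suc)
qed

lemma wx_le_1: "0 < m \<Longrightarrow> wx m \<le> 1"
  using w_bounds(2) [of m] q power_le_one [of q m] by linarith

text \<open>The letter \<open>Y\<close> preserves nonnegative functions of size
  \<open>O(q^m)\<close>, the invariant of the induction over an index.\<close>

lemma sum_wy_bound:
  assumes g: "\<And>a. 0 < a \<Longrightarrow> 0 \<le> g a" "\<And>a. 0 < a \<Longrightarrow> g a \<le> B * q ^ a"
  shows "(\<lambda>a. wy a * g a) summable_on {m<..}"
    and "0 \<le> (\<Sum>\<^sub>\<infinity>a\<in>{m<..}. wy a * g a)"
    and "(\<Sum>\<^sub>\<infinity>a\<in>{m<..}. wy a * g a) \<le> 4 * B / (1 - q)\<^sup>2 * q ^ m"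
proof -
  have nonneg: "0 \<le> wy a * g a" if "m < a" for a
    using g w_bounds that by simp
  have le: "wy a * g a \<le> 4 / (1 - q) * B * q ^ a" if "m < a" for a
    using mult_mono [OF w_bounds(4) g(2), of a a] g w_bounds that q by (simp add: mult.assoc)
  show sum: "(\<lambda>a. wy a * g a) summable_on {m<..}"
    by (rule abs_summable_summable [OF abs_summable_geometric_bound [where c = "4 / (1 - q) * B"]])
      (use nonneg le in simp)
  show "0 \<le> (\<Sum>\<^sub>\<infinity>a\<in>{m<..}. wy a * g a)"
    by (rule infsum_nonneg) (use nonneg in auto)
  have "0 \<le> B * q" using g [of 1] by simp
  then have B: "0 \<le> B" using q by (simp add: zero_le_mult_iff)
  have "(\<lambda>k. q ^ k) sums (1 / (1 - q))"
    using q by (intro geometric_sums) simp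
  then have "((\<lambda>k. q ^ k) has_sum (1 / (1 - q))) UNIV"
    using q by (intro sums_nonneg_imp_has_sum) auto
  then have "((\<lambda>k. 4 / (1 - q) * B * q ^ Suc m * q ^ k) has_sum
      4 / (1 - q) * B * q ^ Suc m * (1 / (1 - q))) UNIV"
    by (rule has_sum_cmult_right)
  then have "((\<lambda>a. 4 / (1 - q) * B * q ^ a) has_sum
      4 / (1 - q) * B * q ^ Suc m * (1 / (1 - q))) {m<..}"
    by (rule has_sum_reindex_bij_witness
        [where i = "\<lambda>a. a - Suc m" and j = "\<lambda>k. Suc m + k", THEN iffD1, rotated -1])
      (auto simp: power_add)
  with has_sum_infsum [OF sum]
  have "(\<Sum>\<^sub>\<infinity>a\<in>{m<..}. wy a * g a) \<le> 4 / (1 - q) * B * q ^ Suc m * (1 / (1 - q))"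
    by (rule has_sum_mono) (use le in auto)
  also have "\<dots> = 4 * B / (1 - q)\<^sup>2 * q ^ m * q"
    by (simp add: power2_eq_square)
  also have "\<dots> \<le> 4 * B / (1 - q)\<^sup>2 * q ^ m"
    using B q by (intro mult_left_le) auto
  finally show "(\<Sum>\<^sub>\<infinity>a\<in>{m<..}. wy a * g a) \<le> 4 * B / (1 - q)\<^sup>2 * q ^ m" .
qed

lemma O_term_nonneg:
  assumes "ms \<in> tuples_above m (length ks)" "\<forall>k\<in>set ks. 1 \<le> k"
  shows "0 \<le> O_term q \<xi> \<eta> ks ms"
  using assms
proof (induction ks arbitrary: m ms)
  case Nil
  then show ?case by (simp add: O_term_def)
next
  case (Cons k ks)
  then obtain a ns where ms: "ms = a # ns"
    by (auto simp: tuples_above_def length_Suc_conv)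
  with Cons.prems have "0 < a" "ns \<in> tuples_above a (length ks)"
    by (auto simp: tuples_above_def)
  with Cons ms w_bounds [of a] show ?case
    by (simp add: O_term_Cons)
qed

text \<open>All terms are nonnegative, so summability of the iterated sum gives absolute summability
  over the tuples.\<close>

lemma has_sum_O_term_Cons:
  assumes k: "1 \<le> k" "\<forall>k\<in>set ks. 1 \<le> k"
    and f: "\<And>a. (O_term q \<xi> \<eta> ks has_sum f a) (tuples_above a (length ks))"
    and g: "\<And>a. 0 < a \<Longrightarrow> 0 \<le> wx a ^ (k - 1) * f a"
      "\<And>a. 0 < a \<Longrightarrow> wx a ^ (k - 1) * f a \<le> B * q ^ a"
  shows "(O_term q \<xi> \<eta> (k # ks) has_sum (\<Sum>\<^sub>\<infinity>a\<in>{m<..}. wy a * (wx a ^ (k - 1) * f a)))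
      (tuples_above m (length (k # ks)))"
proof -
  define S where "S = (SIGMA a:{m<..}. tuples_above a (length ks))"
  define h where "h = (\<lambda>(a, ns). O_term q \<xi> \<eta> (k # ks) (a # ns))"
  have inner: "((\<lambda>ns. h (a, ns)) has_sum wy a * (wx a ^ (k - 1) * f a)) (tuples_above a (length ks))"
    if "a \<in> {m<..}" for a
    using has_sum_cmult_right [OF f, of "wy a * wx a ^ (k - 1)" a] that k
    by (simp add: h_def O_term_Cons mult.assoc)
  have nonneg: "0 \<le> h z" if "z \<in> S" for z
    using that k by (auto simp: S_def h_def tuples_above_Cons intro!: O_term_nonneg [of _ m])
  have "h abs_summable_on S"
    unfolding S_def
  proof (subst abs_summable_on_Sigma_iff, intro conjI ballI)
    have norm: "norm (h (a, ns)) = h (a, ns)" if "a \<in> {m<..}" "ns \<in> tuples_above a (length ks)" for a ns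
      using nonneg [of "(a, ns)"] that by (simp add: S_def)
    fix a assume a: "a \<in> {m<..}"
    show "(\<lambda>ns. h (a, ns)) abs_summable_on tuples_above a (length ks)"
      using inner [OF a] norm [OF a] by (auto simp: summable_on_def cong: has_sum_cong)
  next
    have "(\<Sum>\<^sub>\<infinity>ns\<in>tuples_above a (length ks). norm (h (a, ns))) = wy a * (wx a ^ (k - 1) * f a)"
      if a: "a \<in> {m<..}" for a
      using inner [OF a] nonneg a
      by (intro infsumI) (auto simp: S_def cong: has_sum_cong)
    moreover have "(\<lambda>a. wy a * (wx a ^ (k - 1) * f a)) abs_summable_on {m<..}"
      by (rule summable_on_iff_abs_summable_on_real [THEN iffD1])
        (rule sum_wy_bound(1) [of "\<lambda>a. wx a ^ (k - 1) * f a", OF g])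
    ultimately show "(\<lambda>a. \<Sum>\<^sub>\<infinity>ns\<in>tuples_above a (length ks). norm (h (a, ns))) abs_summable_on {m<..}"
      by (subst summable_on_cong [where g = "\<lambda>a. norm (wy a * (wx a ^ (k - 1) * f a))"]) simp_all
  qed
  then have "h summable_on S"
    by (rule abs_summable_summable)
  then have "(h has_sum (\<Sum>\<^sub>\<infinity>a\<in>{m<..}. wy a * (wx a ^ (k - 1) * f a))) S"
    unfolding S_def
    by (intro has_sum_SigmaI [OF inner] has_sum_infsum
        sum_wy_bound(1) [of "\<lambda>a. wx a ^ (k - 1) * f a", OF g])
  then show ?thesis
    by (rule has_sum_reindex_bij_witness
        [where i = "\<lambda>ms. (hd ms, tl ms)" and j = "\<lambda>(a, ns). a # ns", THEN iffD1, rotated -1])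
      (auto simp: S_def h_def tuples_above_def length_Suc_conv)
qed

text \<open>The sum and its bound are proved together, because the decay of the inner sum makes the
  next outer one converge.\<close>

lemma has_sum_O_term:
  assumes "admissible ks"
  shows "(\<forall>m. (O_term q \<xi> \<eta> ks has_sum foldr act (letters (index_word ks)) (\<lambda>_. 1) m)
      (tuples_above m (length ks))) \<and>
    (\<exists>B. \<forall>m. 0 \<le> foldr act (letters (index_word ks)) (\<lambda>_. 1) m \<and>
      foldr act (letters (index_word ks)) (\<lambda>_. 1) m \<le> B * q ^ m)"
  using assms
proof (induction ks)
  case Nil
  then show ?case by (simp add: admissible_def)
next
  case (Cons k ks)
  define f where "f = foldr act (letters (index_word ks)) (\<lambda>_. 1)"
  have k: "1 \<le> k" "\<forall>k\<in>set ks. 1 \<le> k" using Cons.prems by (auto simp: admissible_def)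
  have "(\<forall>a. (O_term q \<xi> \<eta> ks has_sum f a) (tuples_above a (length ks))) \<and>
    (\<exists>B. \<forall>a>0. 0 \<le> wx a ^ (k - 1) * f a \<and> wx a ^ (k - 1) * f a \<le> B * q ^ a)"
  proof (cases "ks = []")
    case True
    have "((\<lambda>_. 1 :: real) has_sum 1) {[] :: nat list}"
      by (rule has_sum_finiteI) auto
    moreover have "tuples_above a 0 = {[]}" for a by (auto simp: tuples_above_def)
    moreover have "O_term q \<xi> \<eta> [] = (\<lambda>_. 1)" by (simp add: O_term_def fun_eq_iff)
    \<comment> \<open>The constant 1 does not decay; the last entry is at least 2, so at least one
      factor \<open>wx\<close> supplies \<open>q^a\<close>.\<close>
    moreover have "wx a ^ (k - 1) \<le> q ^ a" if "0 < a" for a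
    proof -
      have "wx a ^ (k - 1) \<le> wx a ^ 1"
        using Cons.prems True w_bounds [OF that] wx_le_1 [OF that]
        by (intro power_decreasing) (auto simp: admissible_def)
      then show ?thesis using w_bounds [OF that] by simp
    qed
    ultimately show ?thesis
      using True w_bounds by (auto simp: f_def intro!: exI [of _ 1])
  next
    case False
    then have "admissible ks" using Cons.prems by (auto simp: admissible_def)
    with Cons.IH obtain B where
      IH: "\<And>a. (O_term q \<xi> \<eta> ks has_sum f a) (tuples_above a (length ks))"
        "\<And>a. 0 \<le> f a" "\<And>a. f a \<le> B * q ^ a"
      by (auto simp: f_def)
    have "wx a ^ (k - 1) * f a \<le> B * q ^ a" if "0 < a" for a
    proof -
      have "wx a ^ (k - 1) * f a \<le> 1 * f a"
        using w_bounds [OF that] wx_le_1 [OF that] IH(2)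
        by (intro mult_right_mono power_le_one) auto
      then show ?thesis using IH(3) [of a] by simp
    qed
    then show ?thesis using IH w_bounds by (auto intro!: exI [of _ B])
  qed
  then obtain B where f: "\<And>a. (O_term q \<xi> \<eta> ks has_sum f a) (tuples_above a (length ks))"
    and g: "\<And>a. 0 < a \<Longrightarrow> 0 \<le> wx a ^ (k - 1) * f a"
      "\<And>a. 0 < a \<Longrightarrow> wx a ^ (k - 1) * f a \<le> B * q ^ a"
    by blast
  have eq: "foldr act (letters (index_word (k # ks))) (\<lambda>_. 1) m =
      (\<Sum>\<^sub>\<infinity>a\<in>{m<..}. wy a * (wx a ^ (k - 1) * f a))" for m
    by (simp add: act_X_funpow f_def)
  show ?case
    unfolding eq
    using has_sum_O_term_Cons [OF k f g]
      sum_wy_bound(2,3) [of "\<lambda>a. wx a ^ (k - 1) * f a" B, OF g]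
    by blast
qed

lemma O_term_abs_summable:
  assumes "admissible ks"
  shows "O_term q \<xi> \<eta> ks abs_summable_on increasing_tuples (length ks)"
  using has_sum_O_term [OF assms]
  unfolding summable_on_iff_abs_summable_on_real [symmetric] tuples_above_0 [symmetric]
  by (blast intro: has_sum_imp_summable)

lemma O_index_eq:
  assumes "admissible ks"
  shows "O_index q \<xi> \<eta> ks = foldr act (letters (index_word ks)) (\<lambda>_. 1) 0"
  unfolding O_index_def tuples_above_0 [symmetric]
  using has_sum_O_term [OF assms] by (blast intro: infsumI)

section \<open>The operators\<close>

text \<open>An entry \<open>(i, j)\<close> of a bounded double sequence \<open>h\<close> encodes the value
  \<open>q ^ (i + j) * h (i, j)\<close> at the summation indices \<open>(i + 1, j + 1)\<close>.\<close>

definition kx where "kx i j = (if j = i then wx (Suc i) else 0)"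
definition ky where "ky i j = (if i < j then wy (Suc j) * q ^ (j - i) else 0)"
text \<open>The outermost \<open>Y\<close> is evaluated at 0, which is not an encoded index. Its
  rows are all equal, so the result is constant in that index.\<close>

definition kl :: "nat \<Rightarrow> nat \<Rightarrow> real" where "kl i j = wy (Suc j) * q ^ j"

lemma infsum_Suc_greaterThan: "(\<Sum>\<^sub>\<infinity>a\<in>{Suc i<..}. f a) = (\<Sum>\<^sub>\<infinity>j\<in>{i<..}. f (Suc j))"
  by (rule infsum_reindex_bij_witness [where i = Suc and j = "\<lambda>a. a - 1"]) auto

lemma infsum_Suc_UNIV: "(\<Sum>\<^sub>\<infinity>a\<in>{0<..}. f a) = (\<Sum>\<^sub>\<infinity>j. f (Suc j))"
  by (rule infsum_reindex_bij_witness [where i = Suc and j = "\<lambda>a. a - 1"]) auto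

lemma bounded_kernel_kx: "bounded_kernel kx 1"
  unfolding bounded_kernel_def
proof
  fix i
  have "((\<lambda>j. \<bar>kx i j\<bar>) has_sum \<bar>wx (Suc i)\<bar>) {i}"
    by (rule has_sum_finiteI) (auto simp: kx_def)
  then have "((\<lambda>j. \<bar>kx i j\<bar>) has_sum \<bar>wx (Suc i)\<bar>) UNIV"
    by (rule has_sum_cong_neutral [THEN iffD1, rotated -1]) (auto simp: kx_def)
  then show "(\<lambda>j. \<bar>kx i j\<bar>) summable_on UNIV \<and> (\<Sum>\<^sub>\<infinity>j. \<bar>kx i j\<bar>) \<le> 1"
    using w_bounds [of "Suc i"] wx_le_1 [of "Suc i"]
    by (auto simp: infsumI intro: has_sum_imp_summable)
qed

lemma bounded_kernel_wy:
  fixes K :: "nat \<Rightarrow> nat \<Rightarrow> real"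
  assumes "\<And>i j. K i j = (if j \<in> A i then wy (Suc j) * q ^ (j - s i) else 0)"
    and "\<And>i j. j \<in> A i \<Longrightarrow> s i \<le> j"
  shows "bounded_kernel K (4 / (1 - q)\<^sup>2)"
  unfolding bounded_kernel_def
proof
  fix i
  have "(\<lambda>k. q ^ k) sums (1 / (1 - q))"
    using q by (intro geometric_sums) simp
  then have "((\<lambda>k. q ^ k) has_sum (1 / (1 - q))) UNIV"
    using q by (intro sums_nonneg_imp_has_sum) auto
  then have "((\<lambda>k. 4 / (1 - q) * q ^ k) has_sum 4 / (1 - q) * (1 / (1 - q))) UNIV"
    by (rule has_sum_cmult_right)
  then have "((\<lambda>j. 4 / (1 - q) * q ^ (j - s i)) has_sum 4 / (1 - q) * (1 / (1 - q))) {s i..}"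
    by (rule has_sum_reindex_bij_witness
        [where i = "\<lambda>j. j - s i" and j = "\<lambda>k. s i + k", THEN iffD1, rotated -1]) auto
  then have *: "((\<lambda>j. if s i \<le> j then 4 / (1 - q) * q ^ (j - s i) else 0) has_sum
      4 / (1 - q) * (1 / (1 - q))) UNIV"
    by (rule has_sum_cong_neutral [THEN iffD1, rotated -1]) auto
  have le: "norm (K i j) \<le> (if s i \<le> j then 4 / (1 - q) * q ^ (j - s i) else 0)" for j
  proof -
    have "\<bar>wy (Suc j) * q ^ (j - s i)\<bar> \<le> 4 / (1 - q) * q ^ (j - s i)"
      using w_bounds [of "Suc j"] q by (simp only: abs_mult) (intro mult_mono, auto)
    then show ?thesis using assms(2) [of j i] q by (auto simp: assms(1))
  qed
  have sum: "K i abs_summable_on UNIV"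
    by (rule abs_summable_on_comparison_test' [OF has_sum_imp_summable [OF *]]) (rule le)
  have "(\<Sum>\<^sub>\<infinity>j. \<bar>K i j\<bar>) \<le> 4 / (1 - q) * (1 / (1 - q))"
    by (rule has_sum_mono [OF has_sum_infsum [OF sum, simplified] *]) (use le in auto)
  then show "(\<lambda>j. \<bar>K i j\<bar>) summable_on UNIV \<and> (\<Sum>\<^sub>\<infinity>j. \<bar>K i j\<bar>) \<le> 4 / (1 - q)\<^sup>2"
    using sum by (simp add: power2_eq_square)
qed

lemma bounded_kernel_ky: "bounded_kernel ky (4 / (1 - q)\<^sup>2)"
  by (rule bounded_kernel_wy [where A = "\<lambda>i. {i<..}" and s = "\<lambda>i. i"]) (auto simp: ky_def)

lemma bounded_kernel_kl: "bounded_kernel kl (4 / (1 - q)\<^sup>2)"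
  by (rule bounded_kernel_wy [where A = "\<lambda>_. UNIV" and s = "\<lambda>_. 0"]) (auto simp: kl_def)

definition rep1 :: "letter \<Rightarrow> dseq \<Rightarrow>\<^sub>L dseq" where
  "rep1 l = kernel_op (case l of X \<Rightarrow> kx | Y \<Rightarrow> ky)"
definition rep2 :: "letter \<Rightarrow> dseq \<Rightarrow>\<^sub>L dseq" where
  "rep2 l = conj_swap (rep1 l)"
definition sum1 :: "dseq \<Rightarrow>\<^sub>L dseq" where "sum1 = kernel_op kl"
definition sum2 :: "dseq \<Rightarrow>\<^sub>L dseq" where "sum2 = conj_swap sum1"

lemma bounded_kernel_letter: "\<exists>B. bounded_kernel (case l of X \<Rightarrow> kx | Y \<Rightarrow> ky) B"
  using bounded_kernel_kx bounded_kernel_ky by (cases l) auto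

lemma rep_commute: "rep1 k (rep2 l h) = rep2 l (rep1 k h)"
  using kernel_op_commute bounded_kernel_letter unfolding rep1_def rep2_def by meson

lemma sum1_rep2: "sum1 (rep2 l h) = rep2 l (sum1 h)"
  using kernel_op_commute bounded_kernel_letter bounded_kernel_kl
  unfolding rep1_def rep2_def sum1_def by meson

lemma sum2_rep1: "sum2 (rep1 l h) = rep1 l (sum2 h)"
  using kernel_op_commute [symmetric] bounded_kernel_letter bounded_kernel_kl
  unfolding rep1_def sum1_def sum2_def by meson

lemma sum1_sum2: "sum1 (sum2 h) = sum2 (sum1 h)"
  using kernel_op_commute bounded_kernel_kl unfolding sum1_def sum2_def by meson

lemma rep1_X: "apply_bcontfun (rep1 X h) (i, n) = wx (Suc i) * apply_bcontfun h (i, n)"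
proof -
  have "((\<lambda>j. kx i j * apply_bcontfun h (j, n)) has_sum wx (Suc i) * apply_bcontfun h (i, n)) {i}"
    by (rule has_sum_finiteI) (auto simp: kx_def)
  then have "((\<lambda>j. kx i j * apply_bcontfun h (j, n)) has_sum wx (Suc i) * apply_bcontfun h (i, n)) UNIV"
    by (rule has_sum_cong_neutral [THEN iffD1, rotated -1]) (auto simp: kx_def)
  then show ?thesis
    by (simp add: rep1_def kernel_op_apply [OF bounded_kernel_kx] infsumI)
qed

lemma rep1_Y:
  "q ^ i * apply_bcontfun (rep1 Y h) (i, n) =
    (\<Sum>\<^sub>\<infinity>a\<in>{Suc i<..}. wy a * (q ^ (a - 1) * apply_bcontfun h (a - 1, n)))"
proof -
  have "q ^ i * apply_bcontfun (rep1 Y h) (i, n) =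
      (\<Sum>\<^sub>\<infinity>j. q ^ i * (ky i j * apply_bcontfun h (j, n)))"
    by (simp only: rep1_def letter.case kernel_op_apply [OF bounded_kernel_ky] infsum_cmult_right')
  also have "\<dots> = (\<Sum>\<^sub>\<infinity>j\<in>{i<..}. wy (Suc j) * (q ^ j * apply_bcontfun h (j, n)))"
    by (rule infsum_cong_neutral) (auto simp: ky_def simp flip: power_add)
  finally show ?thesis
    by (simp add: infsum_Suc_greaterThan)
qed

lemma sum1_eq:
  "apply_bcontfun (sum1 h) (i, n) =
    (\<Sum>\<^sub>\<infinity>a\<in>{0<..}. wy a * (q ^ (a - 1) * apply_bcontfun h (a - 1, n)))"
  by (simp add: sum1_def kernel_op_apply [OF bounded_kernel_kl] infsum_Suc_UNIV kl_def mult.assoc)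

lemma rep1_small: "\<bar>\<xi> * \<eta>\<bar> * norm (rep1 Y o\<^sub>L rep1 X) < 1"
proof -
  have "norm (rep1 Y o\<^sub>L rep1 X) \<le> norm (rep1 Y) * norm (rep1 X)"
    by (rule norm_blinfun_compose)
  also have "\<dots> \<le> 4 / (1 - q)\<^sup>2 * 1"
    using norm_kernel_op_le [OF bounded_kernel_kx] norm_kernel_op_le [OF bounded_kernel_ky]
    by (intro mult_mono) (auto simp: rep1_def)
  finally have "\<bar>\<xi> * \<eta>\<bar> * norm (rep1 Y o\<^sub>L rep1 X) \<le> \<bar>\<xi> * \<eta>\<bar> * (4 / (1 - q)\<^sup>2 * 1)"
    by (rule mult_left_mono) simp
  also have "\<dots> = \<xi> * \<eta> * (4 / (1 - q)\<^sup>2)" using nonneg by simp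
  also have "\<dots> < 1" using small_prod q by simp
  finally show ?thesis .
qed

lemma rep2_small: "\<bar>\<xi> * \<eta>\<bar> * norm (rep2 Y o\<^sub>L rep2 X) < 1"
proof -
  have "rep2 Y o\<^sub>L rep2 X = conj_swap (rep1 Y o\<^sub>L rep1 X)"
    by (rule blinfun_eqI) (simp add: rep2_def)
  then have "\<bar>\<xi> * \<eta>\<bar> * norm (rep2 Y o\<^sub>L rep2 X) \<le> \<bar>\<xi> * \<eta>\<bar> * norm (rep1 Y o\<^sub>L rep1 X)"
    by (simp add: norm_conj_swap_le mult_left_mono)
  then show ?thesis using rep1_small by linarith
qed

section \<open>The connector as an intertwining vector\<close>

definition conn_seq :: dseq where
  "conn_seq = Bcontfun (\<lambda>(i, j). conn (Suc i) (Suc j) / q ^ (i + j))"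

text \<open>Boundedness after removing the weight rests on
  \<open>(i + 1) (j + 1) \<ge> i + j\<close>.\<close>

lemma conn_seq_apply: "apply_bcontfun conn_seq (i, j) = conn (Suc i) (Suc j) / q ^ (i + j)"
proof -
  obtain B where "0 < B" and B: "\<bar>conn m n\<bar> \<le> B * q ^ (m * n)" for m n
    using conn_bound by blast
  have "\<bar>conn (Suc i) (Suc j) / q ^ (i + j)\<bar> \<le> B" for i j
  proof -
    have "q ^ (Suc i * Suc j) \<le> q ^ (i + j)"
      using q by (intro power_decreasing) auto
    then have "\<bar>conn (Suc i) (Suc j)\<bar> \<le> B * q ^ (i + j)"
      using B [of "Suc i" "Suc j"] \<open>0 < B\<close> by (auto intro: order_trans mult_left_mono)
    then show ?thesis using q by (simp add: divide_le_eq)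
  qed
  then show ?thesis
    unfolding conn_seq_def by (subst apply_Bcontfun_nat_prod [of _ B]) auto
qed

lemma conn_seq_weighted:
  assumes "0 < a"
  shows "q ^ (a - 1) * apply_bcontfun conn_seq (a - 1, j) = conn a (Suc j) / q ^ j"
  using assms q by (cases a) (simp_all add: conn_seq_apply power_add)

lemma swap_conn_seq [simp]: "swap_op conn_seq = conn_seq"
  by (rule bcontfun_eqI) (auto simp: swap_op_apply conn_seq_apply conn_commute add.commute)

text \<open>Identifies \<open>D\<close> applied to the connector with \<open>L\<close>: the weights
  satisfy \<open>wy a * wx a = wxy a\<close>, and the powers of \<open>q\<close> from the encoding
  are cleared before the sums are compared.\<close>

lemma conn_seq_D:
  "apply_bcontfun (conn_seq + (\<xi> * \<eta>) *\<^sub>R rep1 Y (rep1 X conn_seq)) (i, j) =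
    L (Suc i) (Suc j) / q ^ (i + j)"
proof -
  have wxy: "wy a * wx a = wxy a" if "0 < a" for a
  proof -
    have "qbracket q a \<noteq> 0" using factor_ge [OF that] q by (simp add: qbracket_def)
    then show ?thesis by (simp add: wx_def wy_def wxy_def)
  qed
  have "wy a * (q ^ (a - 1) * apply_bcontfun (rep1 X conn_seq) (a - 1, j)) =
      wxy a * conn a (Suc j) / q ^ j" if "a \<in> {Suc i<..}" for a
  proof -
    have "wy a * (q ^ (a - 1) * apply_bcontfun (rep1 X conn_seq) (a - 1, j)) =
        wy a * wx a * (q ^ (a - 1) * apply_bcontfun conn_seq (a - 1, j))"
      using that by (simp add: rep1_X)
    also have "\<dots> = wxy a * (conn a (Suc j) / q ^ j)"
      using that by (subst wxy, simp, subst conn_seq_weighted) simp_all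
    finally show ?thesis by simp
  qed
  then have "q ^ j * (q ^ i * apply_bcontfun (rep1 Y (rep1 X conn_seq)) (i, j)) =
      q ^ j * (\<Sum>\<^sub>\<infinity>a\<in>{Suc i<..}. wxy a * conn a (Suc j) / q ^ j)"
    unfolding rep1_Y by (simp only: cong: infsum_cong)
  also have "\<dots> = (\<Sum>\<^sub>\<infinity>a\<in>{Suc i<..}. wxy a * conn a (Suc j))"
    unfolding infsum_cmult_right' [symmetric] using q by simp
  finally show ?thesis
    using q by (simp add: L_def conn_seq_apply field_simps power_add)
qed

text \<open>Both \<open>conn_seq\<close> and its image under \<open>D\<close> are symmetric, so
  their difference is too. The scalar, possibly 0, cannot be cancelled.\<close>

lemma conn_seq_yx:
  "(\<xi> * \<eta>) *\<^sub>R rep1 Y (rep1 X conn_seq) = (\<xi> * \<eta>) *\<^sub>R rep2 Y (rep2 X conn_seq)"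
proof -
  have "conn_seq + (\<xi> * \<eta>) *\<^sub>R rep1 Y (rep1 X conn_seq) =
      swap_op (conn_seq + (\<xi> * \<eta>) *\<^sub>R rep1 Y (rep1 X conn_seq))"
  proof (rule bcontfun_eqI, clarify)
    fix i j
    show "apply_bcontfun (conn_seq + (\<xi> * \<eta>) *\<^sub>R rep1 Y (rep1 X conn_seq)) (i, j) =
        apply_bcontfun (swap_op (conn_seq + (\<xi> * \<eta>) *\<^sub>R rep1 Y (rep1 X conn_seq))) (i, j)"
      unfolding swap_op_apply conn_seq_D by (simp add: L_commute add.commute)
  qed
  then show ?thesis by (simp add: rep2_def blinfun.bilinear_simps)
qed

text \<open>\<open>sum_wy_conn\<close> expresses the left side by \<open>L\<close>, which is
  \<open>D\<close> in the first index; \<open>conn_seq_yx\<close> moves \<open>D\<close> to the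
  second.\<close>

lemma conn_seq_y:
  "rep1 Y conn_seq = rep2 X (conn_seq + (\<xi> * \<eta>) *\<^sub>R rep2 Y (rep2 X conn_seq))"
proof (rule bcontfun_eqI, clarify)
  fix i j
  have "q ^ j * (q ^ i * apply_bcontfun (rep1 Y conn_seq) (i, j)) =
      q ^ j * (\<Sum>\<^sub>\<infinity>a\<in>{Suc i<..}. wy a * conn a (Suc j) / q ^ j)"
    unfolding rep1_Y
    by (intro arg_cong [where f = "\<lambda>x. q ^ j * x"] infsum_cong, subst conn_seq_weighted) auto
  also have "\<dots> = wx (Suc j) * L (Suc i) (Suc j)"
    unfolding infsum_cmult_right' [symmetric] using q by (simp add: sum_wy_conn)
  finally have "apply_bcontfun (rep1 Y conn_seq) (i, j) =
      wx (Suc j) * (L (Suc i) (Suc j) / q ^ (i + j))"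
    using q by (simp add: field_simps power_add)
  also have "\<dots> = apply_bcontfun (rep2 X (conn_seq + (\<xi> * \<eta>) *\<^sub>R rep2 Y (rep2 X conn_seq))) (i, j)"
    unfolding conn_seq_yx [symmetric] conn_seq_D [symmetric]
    by (simp add: rep2_def swap_op_apply rep1_X)
  finally show "apply_bcontfun (rep1 Y conn_seq) (i, j) =
      apply_bcontfun (rep2 X (conn_seq + (\<xi> * \<eta>) *\<^sub>R rep2 Y (rep2 X conn_seq))) (i, j)" .
qed

lemma conn_seq_y':
  "rep2 Y conn_seq = rep1 X (conn_seq + (\<xi> * \<eta>) *\<^sub>R rep1 Y (rep1 X conn_seq))"
  using arg_cong [OF conn_seq_y, of swap_op] by (simp add: rep2_def blinfun.bilinear_simps)

text \<open>Encodes \<open>X\<close> applied to the constant function 1, in the first index alone.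
  The constant itself would become \<open>q^(-i)\<close>, which is unbounded.\<close>

definition x_seq :: dseq where
  "x_seq = Bcontfun (\<lambda>(i, j). wx (Suc i) / q ^ i)"

lemma x_seq_apply: "apply_bcontfun x_seq (i, j) = wx (Suc i) / q ^ i"
proof -
  have "\<bar>wx (Suc i) / q ^ i\<bar> \<le> q" for i
    using w_bounds [of "Suc i"] q by (simp add: divide_le_eq)
  then show ?thesis
    unfolding x_seq_def by (subst apply_Bcontfun_nat_prod [of _ q]) auto
qed

lemma sum2_conn_seq: "sum2 conn_seq = x_seq"
proof (rule bcontfun_eqI, clarify)
  fix i j
  have "q ^ i * apply_bcontfun (sum2 conn_seq) (i, j) =
      q ^ i * (\<Sum>\<^sub>\<infinity>a\<in>{0<..}. wy a * conn (Suc i) a / q ^ i)"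
    unfolding sum2_def blinfun_apply_blinfun_compose swap_op_apply sum1_eq swap_conn_seq
    by (intro arg_cong [where f = "\<lambda>x. q ^ i * x"] infsum_cong, subst conn_seq_weighted)
      (auto simp: conn_commute)
  also have "\<dots> = wx (Suc i)"
    unfolding infsum_cmult_right' [symmetric] using q by (simp add: wx_eq_sum)
  finally show "apply_bcontfun (sum2 conn_seq) (i, j) = apply_bcontfun x_seq (i, j)"
    using q by (simp add: x_seq_apply field_simps)
qed

lemma sum1_conn_seq: "sum1 conn_seq = swap_op x_seq"
  by (simp add: sum2_conn_seq [symmetric] sum2_def)

text \<open>\<open>x_seq\<close> is replaced by \<open>sum2 conn_seq\<close>, the word crosses from
  the first index to the second as its image under \<open>tau\<close>, and the commuting outer sums
  are exchanged. The remaining \<open>swap_op\<close> fixes the entry \<open>(0, 0)\<close>.\<close>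

lemma sum1_op_series_tau:
  assumes w: "w \<in> alg_A"
  shows "apply_bcontfun (sum1 (op_series rep1 (\<xi> * \<eta>) w x_seq)) (0, 0) =
    apply_bcontfun (sum1 (op_series rep1 (\<xi> * \<eta>) (tau w) x_seq)) (0, 0)"
proof -
  let ?t = "\<xi> * \<eta>"
  note tw = tau_in_A [OF w]
  have "sum1 (op_series rep1 ?t w x_seq) = sum1 (sum2 (op_series rep1 ?t w conn_seq))"
    by (simp add: op_series_intertwine [OF rep1_small rep1_small w sum2_rep1] sum2_conn_seq)
  also have "\<dots> = sum1 (sum2 (op_series rep2 ?t (tau w) conn_seq))"
    by (simp only: op_series_tau [OF rep1_small rep2_small rep_commute conn_seq_yx conn_seq_y
          conn_seq_y' w])
  also have "\<dots> = sum2 (op_series rep2 ?t (tau w) (swap_op x_seq))"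
    by (simp add: sum1_sum2 op_series_intertwine [OF rep2_small rep2_small tw sum1_rep2]
        sum1_conn_seq)
  also have "\<dots> = swap_op (sum1 (op_series rep1 ?t (tau w) x_seq))"
  proof -
    have "swap_op (rep2 l h) = rep1 l (swap_op h)" for l h
      by (simp add: rep2_def)
    from op_series_intertwine [OF rep2_small rep1_small tw this, of "swap_op x_seq"]
    show ?thesis by (simp add: sum2_def)
  qed
  finally show ?thesis by (simp add: swap_op_apply)
qed

section \<open>Values of \<open>O\<close> as entries of operators\<close>

lemma foldr_act_eq_op_word:
  "foldr act v wx (Suc i) = q ^ i * apply_bcontfun (op_word rep1 v x_seq) (i, n)"
proof (induction v arbitrary: i)
  case Nil
  show ?case using q by (simp add: x_seq_apply)
next
  case (Cons l v)
  show ?case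
  proof (cases l)
    case X
    then show ?thesis by (simp add: Cons rep1_X)
  next
    case Y
    have "foldr act v wx a = q ^ (a - 1) * apply_bcontfun (op_word rep1 v x_seq) (a - 1, n)"
      if "0 < a" for a
      using Cons [of "a - 1"] that by simp
    with Y show ?thesis by (auto simp: rep1_Y intro!: infsum_cong)
  qed
qed

text \<open>The final x turns the constant 1 into \<open>x_seq\<close>, and the leading y becomes
  \<open>sum1\<close>.\<close>

lemma O_poly_eq:
  "O_poly q \<xi> \<eta> (monomial [Y] * p * monomial [X]) = apply_bcontfun (sum1 (op_poly rep1 p x_seq)) (0, 0)"
proof (induction p rule: nc_poly_induct)
  case zero
  show ?case by (simp add: O_poly_def)
next
  case (single v c)
  define w where "w = Word (Y # letters v @ [X])"
  have "w \<in> index_word ` {ks. admissible ks}"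
    unfolding bij_betw_imp_surj_on [OF bij_betw_index_word] by (auto simp: w_def)
  then obtain ks where ks: "admissible ks" "index_word ks = w"
    by blast
  have "monomial [Y] * Poly_Mapping.single v c * monomial [X] = Poly_Mapping.single (index_word ks) c"
    by (simp add: mult_single plus_word_def ks w_def)
  then have "O_poly q \<xi> \<eta> (monomial [Y] * Poly_Mapping.single v c * monomial [X]) =
      of_rat c * foldr act (letters w) (\<lambda>_. 1) 0"
    by (simp only: O_poly_index [OF ks(1)] O_index_eq [OF ks(1)]) (simp only: ks(2))
  also have "foldr act (letters w) (\<lambda>_. 1) 0 = (\<Sum>\<^sub>\<infinity>a\<in>{0<..}. wy a * foldr act (letters v) wx a)"
  proof -
    have "act X (\<lambda>_. 1) = wx" by (simp add: fun_eq_iff)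
    then show ?thesis by (simp add: w_def)
  qed
  also have "\<dots> = apply_bcontfun (sum1 (op_word rep1 (letters v) x_seq)) (0, 0)"
    unfolding sum1_eq
  proof (rule infsum_cong)
    fix a :: nat assume "a \<in> {0<..}"
    then show "wy a * foldr act (letters v) wx a =
        wy a * (q ^ (a - 1) * apply_bcontfun (op_word rep1 (letters v) x_seq) (a - 1, 0))"
      using foldr_act_eq_op_word [of "letters v" "a - 1" 0] by simp
  qed
  finally show ?case by (simp add: op_poly_single blinfun.bilinear_simps)
next
  case (add p r)
  then show ?case
    by (simp add: distrib_left distrib_right O_poly_add op_poly_add blinfun.bilinear_simps)
qed

lemma O_poly_nth_eq:
  "O_poly q \<xi> \<eta> (fps_nth (gen_y * w * gen_x) i) * \<xi> ^ i * \<eta> ^ i =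
    apply_bcontfun (sum1 (op_term rep1 (\<xi> * \<eta>) w i x_seq)) (0, 0)"
  by (simp add: gen_x_def gen_y_def O_poly_eq op_term_def blinfun.bilinear_simps power_mult_distrib)

lemma O_poly_nth_summable:
  assumes "w \<in> alg_A"
  shows "summable (\<lambda>i. \<bar>O_poly q \<xi> \<eta> (fps_nth (gen_y * w * gen_x) i) * \<xi> ^ i * \<eta> ^ i\<bar>)"
proof -
  have sum: "summable (\<lambda>i. norm sum1 * norm x_seq * norm (op_term rep1 (\<xi> * \<eta>) w i))"
    by (intro summable_mult op_term_summable rep1_small assms)
  have "\<bar>apply_bcontfun (sum1 (op_term rep1 (\<xi> * \<eta>) w i x_seq)) (0, 0)\<bar> \<le>
      norm sum1 * norm x_seq * norm (op_term rep1 (\<xi> * \<eta>) w i)" for i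
  proof -
    have "\<bar>apply_bcontfun (sum1 (op_term rep1 (\<xi> * \<eta>) w i x_seq)) (0, 0)\<bar> \<le>
        norm (sum1 (op_term rep1 (\<xi> * \<eta>) w i x_seq))"
      using norm_bounded by (metis real_norm_def)
    also have "\<dots> \<le> norm sum1 * norm (op_term rep1 (\<xi> * \<eta>) w i x_seq)"
      by (rule norm_blinfun)
    also have "\<dots> \<le> norm sum1 * (norm (op_term rep1 (\<xi> * \<eta>) w i) * norm x_seq)"
      by (intro mult_left_mono norm_blinfun) simp
    finally show ?thesis by (simp add: ac_simps)
  qed
  then show ?thesis
    unfolding O_poly_nth_eq by (intro summable_comparison_test' [OF sum, where N = 0]) simp
qed

lemma O_series_eq:
  assumes "w \<in> alg_A"
  shows "O_series q \<xi> \<eta> (gen_y * w * gen_x) =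
    apply_bcontfun (sum1 (op_series rep1 (\<xi> * \<eta>) w x_seq)) (0, 0)"
proof -
  have "norm (apply_bcontfun h (0, 0)) \<le> norm h" for h :: dseq
    by (rule norm_bounded)
  then have "bounded_linear (\<lambda>h :: dseq. apply_bcontfun h (0, 0))"
    by (intro bounded_linear_intro [where K = 1]) auto
  then have "(\<lambda>i. apply_bcontfun (sum1 (op_term rep1 (\<xi> * \<eta>) w i x_seq)) (0, 0)) sums
      apply_bcontfun (sum1 (op_series rep1 (\<xi> * \<eta>) w x_seq)) (0, 0)"
    by (rule bounded_linear.sums)
      (intro bounded_linear.sums [OF blinfun.bounded_linear_right]
        bounded_linear.sums [OF blinfun.bounded_linear_left] op_term_sums rep1_small assms)
  then show ?thesis
    unfolding O_series_def O_poly_nth_eq by (rule sums_unique [symmetric])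
qed

end

section \<open>Choice of the bound and conclusion\<close>

lemma connected_sum_small:
  fixes q :: real
  assumes q: "0 < q" "q < 1"
  shows "\<exists>\<delta>>0. \<forall>\<xi> \<eta>. 0 \<le> \<xi> \<and> \<xi> < \<delta> \<and> 0 \<le> \<eta> \<and> \<eta> < \<delta> \<longrightarrow> connected_sum q \<xi> \<eta>"
proof -
  \<comment> \<open>Chosen so that \<open>A^2 q = (1 + q) / 2\<close>; both factors
    \<open>1 + (1 - q) \<xi>\<close> and \<open>1 + (1 - q) \<eta>\<close> may then be as large as
    \<open>A\<close>, which exceeds 1.\<close>
  define A where "A = sqrt ((1 + q) / (2 * q))"
  have "1 < A" using q by (simp add: A_def)
  have A: "A * A * q = (1 + q) / 2" using q by (simp add: A_def)
  define \<delta> where "\<delta> = min ((A - 1) / (1 - q)) ((1 - q) / 2)"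
  have "connected_sum q \<xi> \<eta>" if "0 \<le> \<xi>" "\<xi> < \<delta>" "0 \<le> \<eta>" "\<eta> < \<delta>" for \<xi> \<eta>
  proof
    show "0 < q" "q < 1" "0 \<le> \<xi>" "0 \<le> \<eta>" by fact+
    have le: "1 + (1 - q) * x \<le> A" if "x < \<delta>" for x
    proof -
      have "x < (A - 1) / (1 - q)" using that by (simp add: \<delta>_def)
      then show ?thesis using q by (simp add: less_divide_eq mult.commute)
    qed
    have "(1 + (1 - q) * \<xi>) * (1 + (1 - q) * \<eta>) * q \<le> A * A * q"
      using le that q \<open>1 < A\<close> by (intro mult_mono) auto
    then show "(1 + (1 - q) * \<xi>) * (1 + (1 - q) * \<eta>) * q \<le> (1 + q) / 2"
      by (simp add: A)
    have "\<xi> * \<eta> < (1 - q) / 2 * ((1 - q) / 2)"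
      using that by (intro mult_strict_mono') (auto simp: \<delta>_def)
    then show "\<xi> * \<eta> * 4 < (1 - q)\<^sup>2"
      by (simp add: power2_eq_square field_simps)
  qed
  moreover have "0 < \<delta>" using q \<open>1 < A\<close> by (simp add: \<delta>_def)
  ultimately show ?thesis by blast
qed

theorem theorem1p2:
  fixes q :: real
  assumes "0 < q" and "q < 1"
  shows "\<exists>\<delta>>0. \<forall>\<xi> \<eta>. 0 \<le> \<xi> \<and> \<xi> < \<delta> \<and> 0 \<le> \<eta> \<and> \<eta> < \<delta> \<longrightarrow>
    (\<forall>ks. admissible ks \<longrightarrow> O_term q \<xi> \<eta> ks abs_summable_on increasing_tuples (length ks)) \<and>
    (\<forall>w\<in>alg_A.
      summable (\<lambda>i. \<bar>O_poly q \<xi> \<eta> (fps_nth (gen_y * w * gen_x) i) * \<xi> ^ i * \<eta> ^ i\<bar>) \<and>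
      O_series q \<xi> \<eta> (gen_y * w * gen_x) = O_series q \<xi> \<eta> (gen_y * tau w * gen_x))"
proof -
  obtain \<delta> where "0 < \<delta>"
    and \<delta>: "\<And>\<xi> \<eta>. 0 \<le> \<xi> \<and> \<xi> < \<delta> \<and> 0 \<le> \<eta> \<and> \<eta> < \<delta> \<Longrightarrow> connected_sum q \<xi> \<eta>"
    using connected_sum_small [OF assms] by blast
  show ?thesis
  proof (intro exI [of _ \<delta>] conjI allI impI ballI)
    fix \<xi> \<eta> w ks
    assume "0 \<le> \<xi> \<and> \<xi> < \<delta> \<and> 0 \<le> \<eta> \<and> \<eta> < \<delta>"
    then interpret connected_sum q \<xi> \<eta> by (rule \<delta>)
    show "O_term q \<xi> \<eta> ks abs_summable_on increasing_tuples (length ks)" if "admissible ks"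
      using that by (rule O_term_abs_summable)
    assume w: "w \<in> alg_A"
    show "summable (\<lambda>i. \<bar>O_poly q \<xi> \<eta> (fps_nth (gen_y * w * gen_x) i) * \<xi> ^ i * \<eta> ^ i\<bar>)"
      by (rule O_poly_nth_summable [OF w])
    show "O_series q \<xi> \<eta> (gen_y * w * gen_x) = O_series q \<xi> \<eta> (gen_y * tau w * gen_x)"
      using sum1_op_series_tau [OF w] by (simp only: O_series_eq w tau_in_A)
  qed fact
qed

end
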